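(* Let $G$ be a (topologically) finitely generated Fitting-free profinite group and let $c$ be a non-negative integer. Then $G$ is JNN$_c$F if and only if there is a descending sequence $G\geq H_0>H_1>H_2>\cdots$ of open normal subgroups of $G$ such that (i) $\bigcap_{n=0}^{\infty}H_n=1$, and (ii) if $N$ is an open normal subgroup of $G$ and $n\geq 1$, then either $\gamma_{c+1}(N)\leq H_{n-1}$ or $\gamma_{c+1}(H_n)\leq\gamma_{c+1}(N)$. Furthermore, when these conditions are satisfied, the group $G$ is just infinite if and only if $\gamma_{c+1}(H_n)$ has finite index in $G$ for all $n\geq 0$.
   Context: For closed subgroups $K,L$ of a profinite group, $[K,L]$ denotes the closed subgroup generated by all commutators $[x,y]$ with $x\in K$, $y\in L$. The lower central series is $\gamma_1(K)=K$, $\gamma_{i+1}(K)=[\gamma_i(K),K]$. A profinite group is virtually class-$c$ nilpotent if it has a subgroup $H$ of finite index (equivalently, an open subgroup $H$) with $\gamma_{c+1}(H)=1$. A profinite group $G$ is JNN$_c$F if $G$ is not virtually class-$c$ nilpotent but $G/N$ is virtually class-$c$ nilpotent for every non-trivial closed normal subgroup $N$ of $G$. A profinite group is just infinite if it is infinite and every quotient by a non-trivial closed normal subgroup is finite. A profinite group is Fitting-free if it has no non-trivial abelian closed normal subgroup. *)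

theory Defs
  imports "HOL-Analysis.Analysis" "HOL-Algebra.Algebra"
begin

locale topological_group = group G for G (structure) +
  fixes T :: "'a topology"
  assumes topspace_eq: "topspace T = carrier G"
    and mult_continuous: "continuous_map (prod_topology T T) T (\<lambda>(x, y). x \<otimes> y)"
    and inv_continuous: "continuous_map T T (\<lambda>x. inv x)"

definition totally_disconnected_space :: "'a topology \<Rightarrow> bool" where
  "totally_disconnected_space T \<longleftrightarrow> (\<forall>S. connectedin T S \<longrightarrow> (\<forall>x\<in>S. \<forall>y\<in>S. x = y))"

locale profinite_group = topological_group G T for G (structure) and T +
  assumes compact: "compact_space T"
    and Hausdorff: "Hausdorff_space T"
    and totally_disconnected: "totally_disconnected_space T"

definition closed_subgroup_generated ::
    "('a, 'b) monoid_scheme \<Rightarrow> 'a topology \<Rightarrow> 'a set \<Rightarrow> 'a set" where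
  "closed_subgroup_generated G T S = (\<lambda>H. subgroup H G \<and> closedin T H) hull S"

definition topologically_fg :: "('a, 'b) monoid_scheme \<Rightarrow> 'a topology \<Rightarrow> bool" where
  "topologically_fg G T \<longleftrightarrow>
     (\<exists>S. finite S \<and> S \<subseteq> carrier G \<and> closed_subgroup_generated G T S = carrier G)"

definition commutator :: "('a, 'b) monoid_scheme \<Rightarrow> 'a \<Rightarrow> 'a \<Rightarrow> 'a" where
  "commutator G x y = inv\<^bsub>G\<^esub> x \<otimes>\<^bsub>G\<^esub> inv\<^bsub>G\<^esub> y \<otimes>\<^bsub>G\<^esub> x \<otimes>\<^bsub>G\<^esub> y"

definition commutator_subgroup ::
    "('a, 'b) monoid_scheme \<Rightarrow> 'a topology \<Rightarrow> 'a set \<Rightarrow> 'a set \<Rightarrow> 'a set" where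
  "commutator_subgroup G T K L =
     closed_subgroup_generated G T {commutator G x y | x y. x \<in> K \<and> y \<in> L}"

text \<open>Indexed from \<open>1\<close> as in \<open>\<gamma>\<^sub>1(K) = K\<close>; the value at \<open>0\<close> is a dummy.\<close>

fun lower_central ::
    "('a, 'b) monoid_scheme \<Rightarrow> 'a topology \<Rightarrow> nat \<Rightarrow> 'a set \<Rightarrow> 'a set" where
  "lower_central G T 0 K = K"
| "lower_central G T (Suc 0) K = K"
| "lower_central G T (Suc (Suc i)) K =
     commutator_subgroup G T (lower_central G T (Suc i) K) K"

text \<open>For profinite \<open>G\<close> the open subgroups are exactly the closed subgroups of finite index.\<close>

definition virtually_nilpotent ::
    "nat \<Rightarrow> ('a, 'b) monoid_scheme \<Rightarrow> 'a topology \<Rightarrow> bool" where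
  "virtually_nilpotent c G T \<longleftrightarrow>
     (\<exists>H. subgroup H G \<and> openin T H \<and> lower_central G T (c + 1) H = {\<one>\<^bsub>G\<^esub>})"

text \<open>The quotient topology on \<open>G Mod N\<close>, whose points are the cosets of \<open>N\<close>.\<close>

definition quotient_topology ::
    "('a, 'b) monoid_scheme \<Rightarrow> 'a topology \<Rightarrow> 'a set \<Rightarrow> 'a set topology" where
  "quotient_topology G T N =
     topology (\<lambda>U. U \<subseteq> carrier (G Mod N) \<and> openin T {x \<in> topspace T. N #>\<^bsub>G\<^esub> x \<in> U})"

lemma openin_quotient_topology:
  "openin (quotient_topology G T N) U \<longleftrightarrow>
     U \<subseteq> carrier (G Mod N) \<and> openin T {x \<in> topspace T. N #>\<^bsub>G\<^esub> x \<in> U}"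
proof -
  let ?P = "\<lambda>U. U \<subseteq> carrier (G Mod N) \<and> openin T {x \<in> topspace T. N #>\<^bsub>G\<^esub> x \<in> U}"
  have "?P (A \<inter> B)" if "?P A" "?P B" for A B
  proof -
    have "{x \<in> topspace T. N #>\<^bsub>G\<^esub> x \<in> A \<inter> B} =
        {x \<in> topspace T. N #>\<^bsub>G\<^esub> x \<in> A} \<inter> {x \<in> topspace T. N #>\<^bsub>G\<^esub> x \<in> B}" by auto
    with that show ?thesis by auto
  qed
  moreover have "?P (\<Union>\<K>)" if "\<forall>A\<in>\<K>. ?P A" for \<K>
  proof -
    have "{x \<in> topspace T. N #>\<^bsub>G\<^esub> x \<in> \<Union>\<K>} =
        (\<Union>A\<in>\<K>. {x \<in> topspace T. N #>\<^bsub>G\<^esub> x \<in> A})" by auto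
    moreover have "openin T (\<Union>A\<in>\<K>. {x \<in> topspace T. N #>\<^bsub>G\<^esub> x \<in> A})"
      using that by (intro openin_Union) auto
    ultimately show ?thesis using that by auto
  qed
  ultimately have "istopology ?P"
    unfolding istopology_def by blast
  then show ?thesis
    by (simp add: quotient_topology_def topology_inverse')
qed

lemma quotient_map_cosets:
  assumes "topspace T = carrier G"
  shows "quotient_map T (quotient_topology G T N) (\<lambda>x. N #>\<^bsub>G\<^esub> x)"
proof -
  have cosets: "carrier (G Mod N) = (\<lambda>x. N #>\<^bsub>G\<^esub> x) ` topspace T"
    by (auto simp: FactGroup_def RCOSETS_def assms)
  have "{x \<in> topspace T. N #>\<^bsub>G\<^esub> x \<in> carrier (G Mod N)} = topspace T"
    using cosets by auto
  then have "openin (quotient_topology G T N) (carrier (G Mod N))"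
    by (simp add: openin_quotient_topology)
  then have "topspace (quotient_topology G T N) = carrier (G Mod N)"
    by (meson openin_quotient_topology openin_subset openin_topspace subset_antisym)
  then show ?thesis
    by (auto simp: quotient_map_def openin_quotient_topology cosets)
qed

definition JNNF :: "nat \<Rightarrow> ('a, 'b) monoid_scheme \<Rightarrow> 'a topology \<Rightarrow> bool" where
  "JNNF c G T \<longleftrightarrow>
     \<not> virtually_nilpotent c G T \<and>
     (\<forall>N. N \<lhd> G \<and> closedin T N \<and> N \<noteq> {\<one>\<^bsub>G\<^esub>} \<longrightarrow>
        virtually_nilpotent c (G Mod N) (quotient_topology G T N))"

definition just_infinite :: "('a, 'b) monoid_scheme \<Rightarrow> 'a topology \<Rightarrow> bool" where
  "just_infinite G T \<longleftrightarrow>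
     infinite (carrier G) \<and>
     (\<forall>N. N \<lhd> G \<and> closedin T N \<and> N \<noteq> {\<one>\<^bsub>G\<^esub>} \<longrightarrow> finite (carrier (G Mod N)))"

definition Fitting_free :: "('a, 'b) monoid_scheme \<Rightarrow> 'a topology \<Rightarrow> bool" where
  "Fitting_free G T \<longleftrightarrow>
     \<not> (\<exists>N. N \<lhd> G \<and> closedin T N \<and> N \<noteq> {\<one>\<^bsub>G\<^esub>} \<and>
          (\<forall>x\<in>N. \<forall>y\<in>N. x \<otimes>\<^bsub>G\<^esub> y = y \<otimes>\<^bsub>G\<^esub> x))"

definition finite_index :: "('a, 'b) monoid_scheme \<Rightarrow> 'a set \<Rightarrow> bool" where
  "finite_index G H \<longleftrightarrow> finite (rcosets\<^bsub>G\<^esub> H)"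

definition JNN_sequence ::
    "nat \<Rightarrow> ('a, 'b) monoid_scheme \<Rightarrow> 'a topology \<Rightarrow> (nat \<Rightarrow> 'a set) \<Rightarrow> bool" where
  "JNN_sequence c G T H \<longleftrightarrow>
     (\<forall>n. H n \<lhd> G \<and> openin T (H n)) \<and>
     (\<forall>n. H (Suc n) \<subset> H n) \<and>
     (\<Inter>n. H n) = {\<one>\<^bsub>G\<^esub>} \<and>
     (\<forall>N n. N \<lhd> G \<and> openin T N \<and> n \<ge> 1 \<longrightarrow>
        lower_central G T (c + 1) N \<subseteq> H (n - 1) \<or>
        lower_central G T (c + 1) (H n) \<subseteq> lower_central G T (c + 1) N)"

end

theory Submission
  imports Defs
begin

text \<open>Suppose first that \<open>G\<close> is JNN\<open>\<^sub>c\<close>F and let \<open>H\<close> be an open normal subgroup. One needs a single open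
  \<open>M\<close> with \<open>\<gamma>\<^sub>c\<^sub>+\<^sub>1(M) \<le> \<gamma>\<^sub>c\<^sub>+\<^sub>1(N)\<close> for all closed normal \<open>N\<close> with \<open>\<gamma>\<^sub>c\<^sub>+\<^sub>1(N)\<close> not contained in \<open>H\<close>. These \<open>N\<close>
  form a compact space, so it suffices to find \<open>M\<close> for all \<open>A\<close> close to a fixed \<open>N\<close>. Modulo a non-trivial
  closed normal \<open>D\<close> the group \<open>G\<close> is finitely generated and virtually nilpotent of class \<open>c\<close>; there
  \<open>\<gamma>\<^sub>c\<^sub>+\<^sub>1(N) \<le> \<gamma>\<^sub>c\<^sub>+\<^sub>1(A)\<close> whenever \<open>A\<close> is close to \<open>N\<close>, because modulo a normal subgroup contained in
  \<open>\<gamma>\<^sub>c\<^sub>+\<^sub>1(A) D\<close> some open subgroup lies in the \<open>c\<close>-th term of the upper central series of an open subgroup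
  containing \<open>N\<close> and \<open>A\<close>, and \<open>\<gamma>\<^sub>c\<^sub>+\<^sub>1\<close> does not see that term. Taking \<open>D\<close> inside a minimal subgroup below \<open>\<gamma>\<^sub>c\<^sub>+\<^sub>1(N)\<close>
  turns this into an inclusion in \<open>G\<close>.

  Conversely, a non-trivial closed normal \<open>N\<close> has \<open>\<gamma>\<^sub>c\<^sub>+\<^sub>1(N) \<noteq> 1\<close> as \<open>G\<close> is Fitting-free, so
  \<open>\<gamma>\<^sub>c\<^sub>+\<^sub>1(N)\<close> is not contained in some \<open>H\<^sub>n\<close>; then \<open>\<gamma>\<^sub>c\<^sub>+\<^sub>1(H\<^sub>n\<^sub>+\<^sub>1) \<le> N H\<^sub>k\<close> for all \<open>k\<close> and hence
  \<open>\<gamma>\<^sub>c\<^sub>+\<^sub>1(H\<^sub>n\<^sub>+\<^sub>1) \<le> N\<close>.\<close>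

section \<open>Commutators and factor groups\<close>

context group
begin

lemma inv_mult_cancel_left [simp]:
  assumes "x \<in> carrier G" "y \<in> carrier G"
  shows "inv x \<otimes> (x \<otimes> y) = y" "x \<otimes> (inv x \<otimes> y) = y"
  using assms by (simp_all flip: m_assoc)

lemma commutator_closed [simp]:
  "\<lbrakk>x \<in> carrier G; y \<in> carrier G\<rbrakk> \<Longrightarrow> commutator G x y \<in> carrier G"
  by (simp add: commutator_def)

lemma commutator_eq_one_iff:
  assumes "x \<in> carrier G" "y \<in> carrier G"
  shows "commutator G x y = \<one> \<longleftrightarrow> x \<otimes> y = y \<otimes> x"
proof -
  have "commutator G x y = inv (y \<otimes> x) \<otimes> (x \<otimes> y)"
    using assms by (simp add: commutator_def m_assoc inv_mult_group)
  then show ?thesis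
    using assms by (metis inv_closed inv_inv inv_solve_left' m_closed r_one l_inv)
qed

lemma commutator_swap:
  assumes "x \<in> carrier G" "y \<in> carrier G"
  shows "commutator G y x = inv (commutator G x y)"
  using assms by (simp add: commutator_def m_assoc inv_mult_group)

lemma commutator_mult_left:
  assumes "x \<in> carrier G" "y \<in> carrier G" "w \<in> carrier G"
  shows "commutator G (x \<otimes> y) w = inv y \<otimes> commutator G x w \<otimes> y \<otimes> commutator G y w"
  using assms by (simp add: commutator_def m_assoc inv_mult_group)

lemma commutator_mult_right:
  assumes "x \<in> carrier G" "y \<in> carrier G" "w \<in> carrier G"
  shows "commutator G w (x \<otimes> y) = commutator G w y \<otimes> (inv y \<otimes> commutator G w x \<otimes> y)"
  using assms by (simp add: commutator_def m_assoc inv_mult_group)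

lemma commutator_inv_left:
  assumes "x \<in> carrier G" "w \<in> carrier G"
  shows "commutator G (inv x) w = x \<otimes> inv (commutator G x w) \<otimes> inv x"
  using assms by (simp add: commutator_def m_assoc inv_mult_group)

lemma commutator_conj:
  assumes "x \<in> carrier G" "y \<in> carrier G" "g \<in> carrier G"
  shows "commutator G (g \<otimes> x \<otimes> inv g) (g \<otimes> y \<otimes> inv g) = g \<otimes> commutator G x y \<otimes> inv g"
  using assms by (simp add: commutator_def m_assoc inv_mult_group)

lemma commutator_conj_left:
  assumes "x \<in> carrier G" "y \<in> carrier G" "g \<in> carrier G"
  shows "commutator G (g \<otimes> x \<otimes> inv g) y = g \<otimes> commutator G x (inv g \<otimes> y \<otimes> g) \<otimes> inv g"
  using assms by (simp add: commutator_def m_assoc inv_mult_group)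

lemma commutator_in_normal:
  assumes N: "N \<lhd> G" and x: "x \<in> N" and y: "y \<in> carrier G"
  shows "commutator G x y \<in> N" "commutator G y x \<in> N"
proof -
  interpret normal N G by fact
  have xc: "x \<in> carrier G" using x by simp
  have "inv y \<otimes> x \<otimes> y \<in> N" using inv_op_closed1 x y by blast
  moreover have "commutator G x y = inv x \<otimes> (inv y \<otimes> x \<otimes> y)"
    using xc y by (simp add: commutator_def m_assoc)
  ultimately show *: "commutator G x y \<in> N" using x by simp
  then show "commutator G y x \<in> N"
    using commutator_swap[OF xc y] by simp
qed

text \<open>Conjugation by \<open>x\<close> and by \<open>w\<close> fixes the commutator and hence
  its powers, so the product rules for commutators lose their conjugating factors. This is the
  bilinearity used later to move exponents between the two arguments.\<close>

lemma commutator_pow: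
  fixes m :: nat
  assumes x: "x \<in> carrier G" and w: "w \<in> carrier G"
    and xc: "x \<otimes> commutator G x w = commutator G x w \<otimes> x"
    and wc: "w \<otimes> commutator G x w = commutator G x w \<otimes> w"
  shows "commutator G (x [^] m) w = commutator G x w [^] m"
    and "commutator G x (w [^] m) = commutator G x w [^] m"
proof -
  let ?d = "commutator G x w"
  have d: "?d \<in> carrier G" using x w by simp
  have conj_x: "inv x \<otimes> ?d \<otimes> x = ?d"
    using xc d x by (simp add: m_assoc flip: xc)
  have conj_w: "inv w \<otimes> ?d \<otimes> w = ?d"
    using wc d w by (simp add: m_assoc flip: wc)
  show "commutator G (x [^] m) w = ?d [^] m"
  proof (induction m)
    case 0 then show ?case using w by (simp add: commutator_def)
  next
    case (Suc m)
    have "inv x \<otimes> ?d [^] m \<otimes> x = ?d [^] m"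
    proof (induction m)
      case 0 then show ?case using x by simp
    next
      case (Suc m)
      have "inv x \<otimes> ?d [^] Suc m \<otimes> x = (inv x \<otimes> ?d [^] m \<otimes> x) \<otimes> (inv x \<otimes> ?d \<otimes> x)"
        using x d by (simp add: m_assoc)
      then show ?case using Suc conj_x by simp
    qed
    then show ?case using Suc x w by (simp add: commutator_mult_left)
  qed
  show "commutator G x (w [^] m) = ?d [^] m"
  proof (induction m)
    case 0 then show ?case using x by (simp add: commutator_def)
  next
    case (Suc m)
    have "inv w \<otimes> ?d [^] m \<otimes> w = ?d [^] m"
    proof (induction m)
      case 0 then show ?case using w by simp
    next
      case (Suc m)
      have "inv w \<otimes> ?d [^] Suc m \<otimes> w = (inv w \<otimes> ?d [^] m \<otimes> w) \<otimes> (inv w \<otimes> ?d \<otimes> w)"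
        using w d by (simp add: m_assoc)
      then show ?case using Suc conj_w by simp
    qed
    then show ?case using Suc x w d
      by (simp add: commutator_mult_right flip: nat_pow_Suc2)
  qed
qed

text \<open>The element form of the three subgroups lemma: if \<open>g\<close> and \<open>w\<close> move \<open>u\<close> by factors
  on which the other one acts trivially, then the two actions on \<open>u\<close> commute.\<close>

lemma commute_with_commutator:
  assumes u: "u \<in> carrier G" and g: "g \<in> carrier G" and w: "w \<in> carrier G"
    and cw: "commutator G u g \<otimes> w = w \<otimes> commutator G u g"
    and dg: "commutator G u w \<otimes> g = g \<otimes> commutator G u w"
    and cd: "commutator G u g \<otimes> commutator G u w = commutator G u w \<otimes> commutator G u g"
  shows "u \<otimes> commutator G (inv g) (inv w) = commutator G (inv g) (inv w) \<otimes> u"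
proof -
  let ?c = "commutator G u g" and ?d = "commutator G u w"
  have c: "?c \<in> carrier G" and d: "?d \<in> carrier G" using u g w by auto
  have ug: "u \<otimes> g = g \<otimes> (u \<otimes> ?c)" and uw: "u \<otimes> w = w \<otimes> (u \<otimes> ?d)"
    using u g w by (simp_all add: commutator_def m_assoc)
  have "u \<otimes> (g \<otimes> w) = g \<otimes> (u \<otimes> ?c) \<otimes> w"
    using ug u g w by (simp flip: m_assoc)
  also have "\<dots> = g \<otimes> (u \<otimes> w) \<otimes> ?c"
    using u g w c cw by (simp add: m_assoc)
  also have "\<dots> = (g \<otimes> w) \<otimes> u \<otimes> (?d \<otimes> ?c)"
    using u g w c d uw by (simp add: m_assoc)
  finally have 1: "u \<otimes> (g \<otimes> w) = (g \<otimes> w) \<otimes> u \<otimes> (?d \<otimes> ?c)" .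
  have "u \<otimes> (w \<otimes> g) = w \<otimes> (u \<otimes> ?d) \<otimes> g"
    using uw u g w by (simp flip: m_assoc)
  also have "\<dots> = w \<otimes> (u \<otimes> g) \<otimes> ?d"
    using u g w d dg by (simp add: m_assoc)
  also have "\<dots> = (w \<otimes> g) \<otimes> u \<otimes> (?c \<otimes> ?d)"
    using u g w c d ug by (simp add: m_assoc)
  finally have 2: "u \<otimes> (w \<otimes> g) = (w \<otimes> g) \<otimes> u \<otimes> (?d \<otimes> ?c)"
    using cd by simp
  \<comment> \<open>Conjugating \<open>u\<close> by \<open>g \<otimes> w\<close> and by
    \<open>w \<otimes> g\<close> gives the same element \<open>u \<otimes> e\<close>, so
    \<open>a \<otimes> inv b\<close> centralizes \<open>u\<close>. That quotient is the commutator
    of the inverses, which is why inverses occur in the conclusion.\<close>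
  define a b e where "a = g \<otimes> w" and "b = w \<otimes> g" and "e = ?d \<otimes> ?c"
  have abe: "a \<in> carrier G" "b \<in> carrier G" "e \<in> carrier G"
    using a_def b_def e_def g w c d by auto
  have ue: "inv a \<otimes> u \<otimes> a = u \<otimes> e" "inv b \<otimes> u \<otimes> b = u \<otimes> e"
    using 1 2 abe u by (simp_all add: a_def[symmetric] b_def[symmetric] e_def[symmetric] m_assoc)
  have "a \<otimes> inv b \<otimes> u = a \<otimes> (inv b \<otimes> u \<otimes> b) \<otimes> inv b"
    using abe u by (simp add: m_assoc)
  also have "\<dots> = a \<otimes> (inv a \<otimes> u \<otimes> a) \<otimes> inv b"
    using ue by simp
  also have "\<dots> = u \<otimes> (a \<otimes> inv b)"
    using abe u by (simp add: m_assoc)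
  finally have "u \<otimes> (a \<otimes> inv b) = a \<otimes> inv b \<otimes> u" by simp
  moreover have "commutator G (inv g) (inv w) = a \<otimes> inv b"
    using g w by (simp add: commutator_def a_def b_def inv_mult_group m_assoc)
  ultimately show ?thesis by simp
qed

section \<open>Intersections and products of normal subgroups\<close>

lemma normal_Inter:
  assumes "\<F> \<noteq> {}" "\<And>N. N \<in> \<F> \<Longrightarrow> N \<lhd> G"
  shows "\<Inter>\<F> \<lhd> G"
  using assms unfolding normal_inv_iff by (auto intro!: subgroups_Inter)

lemma mem_set_mult: "x \<in> A <#> B \<longleftrightarrow> (\<exists>a\<in>A. \<exists>b\<in>B. x = a \<otimes> b)"
  by (auto simp: set_mult_def)

lemma normal_set_mult_normal:
  assumes A: "A \<lhd> G" and B: "B \<lhd> G"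
  shows "A <#> B \<lhd> G"
proof (rule normal_invI)
  interpret second_isomorphism_grp A G B
    using A B by (simp add: normal_imp_subgroup second_isomorphism_grp_axioms_def second_isomorphism_grp_def)
  show "subgroup (A <#> B) G" by (rule normal_set_mult_subgroup)
  fix x h assume x: "x \<in> carrier G" and "h \<in> A <#> B"
  then obtain a b where ab: "a \<in> A" "b \<in> B" "h = a \<otimes> b" by (auto simp: mem_set_mult)
  then have "a \<in> carrier G" "b \<in> carrier G"
    using A B by (auto dest: normal_imp_subgroup subgroup.mem_carrier)
  then have "x \<otimes> h \<otimes> inv x = (x \<otimes> a \<otimes> inv x) \<otimes> (x \<otimes> b \<otimes> inv x)"
    using ab x by (simp add: m_assoc)
  then show "x \<otimes> h \<otimes> inv x \<in> A <#> B"
    unfolding mem_set_mult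
    using normal.inv_op_closed2[OF A x ab(1)] normal.inv_op_closed2[OF B x ab(2)] by blast
qed

lemma set_mult_upper:
  assumes "subgroup A G" "subgroup B G"
  shows "A \<subseteq> A <#> B" "B \<subseteq> A <#> B"
proof
  fix x assume "x \<in> A"
  then show "x \<in> A <#> B"
    using assms unfolding mem_set_mult
    by (metis r_one subgroup.mem_carrier subgroup.one_closed)
next
  show "B \<subseteq> A <#> B"
    using assms unfolding mem_set_mult subset_iff
    by (metis l_one subgroup.mem_carrier subgroup.one_closed)
qed

lemma set_mult_least:
  assumes "subgroup C G" "A \<subseteq> C" "B \<subseteq> C"
  shows "A <#> B \<subseteq> C"
  using assms by (auto simp: mem_set_mult intro!: subgroup.m_closed[OF assms(1)])

text \<open>The non-trivial half of Dedekind's modular law.\<close>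

lemma Int_set_mult_modular:
  assumes "K \<lhd> G" "L \<subseteq> carrier G" "D \<subseteq> K" "K \<subseteq> L <#> D"
  shows "K \<subseteq> (L \<inter> K) <#> D"
proof
  fix x assume x: "x \<in> K"
  then obtain l d where ld: "l \<in> L" "d \<in> D" "x = l \<otimes> d"
    using assms(4) unfolding subset_iff mem_set_mult by blast
  interpret normal K G by fact
  have "d \<in> K" using ld assms(3) by auto
  have "l = x \<otimes> inv d" using ld assms by (metis \<open>d \<in> K\<close> inv_solve_right mem_carrier subsetD x)
  then have "l \<in> K" using x \<open>d \<in> K\<close> by simp
  then show "x \<in> (L \<inter> K) <#> D" using ld by (auto simp: mem_set_mult)
qed

end

section \<open>Commutator identities modulo a normal subgroup\<close>

context normal
begin

lemma coset_eq_one_iff: "x \<in> carrier G \<Longrightarrow> H #> x = \<one>\<^bsub>G Mod H\<^esub> \<longleftrightarrow> x \<in> H"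
  by (metis coset_join1 coset_join2 is_subgroup one_FactGroup subset)

lemma coset_hom: "group_hom G (G Mod H) ((#>) H)"
  by (simp add: factorgroup_is_group group_hom_axioms_def group_hom_def is_group r_coset_hom_Mod)

lemma coset_commutator:
  assumes "x \<in> carrier G" "y \<in> carrier G"
  shows "H #> commutator G x y = commutator (G Mod H) (H #> x) (H #> y)"
proof -
  interpret h: group_hom G "G Mod H" "(#>) H" by (rule coset_hom)
  show ?thesis using assms
    by (simp only: commutator_def h.hom_mult h.hom_inv m_closed inv_closed)
qed

lemma coset_closed: "x \<in> carrier G \<Longrightarrow> H #> x \<in> carrier (G Mod H)"
  by (simp add: carrier_FactGroup)

lemma coset_commute_iff:
  assumes "x \<in> carrier G" "y \<in> carrier G"
  shows "(H #> x) \<otimes>\<^bsub>G Mod H\<^esub> (H #> y) = (H #> y) \<otimes>\<^bsub>G Mod H\<^esub> (H #> x) \<longleftrightarrow> commutator G x y \<in> H"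
proof -
  interpret Q: group "G Mod H" by (rule factorgroup_is_group)
  show ?thesis
    using Q.commutator_eq_one_iff[OF coset_closed coset_closed, OF assms]
      coset_commutator[OF assms] coset_eq_one_iff[of "commutator G x y"] assms by simp
qed

lemma coset_pow: "x \<in> carrier G \<Longrightarrow> H #> (x [^] (n::nat)) = (H #> x) [^]\<^bsub>G Mod H\<^esub> n"
  by (simp add: FactGroup_pow)

lemma commutator_pow_mod:
  fixes m :: nat
  assumes x: "x \<in> carrier G" and w: "w \<in> carrier G"
    and xc: "commutator G (commutator G x w) x \<in> H"
    and wc: "commutator G (commutator G x w) w \<in> H"
  shows "H #> commutator G (x [^] m) w = H #> (commutator G x w [^] m)"
    and "H #> commutator G x (w [^] m) = H #> (commutator G x w [^] m)"
proof -
  interpret Q: group "G Mod H" by (rule factorgroup_is_group)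
  have *: "(H #> x) \<otimes>\<^bsub>G Mod H\<^esub> commutator (G Mod H) (H #> x) (H #> w) =
      commutator (G Mod H) (H #> x) (H #> w) \<otimes>\<^bsub>G Mod H\<^esub> (H #> x)"
    "(H #> w) \<otimes>\<^bsub>G Mod H\<^esub> commutator (G Mod H) (H #> x) (H #> w) =
      commutator (G Mod H) (H #> x) (H #> w) \<otimes>\<^bsub>G Mod H\<^esub> (H #> w)"
    using coset_commute_iff[of "commutator G x w" x] coset_commute_iff[of "commutator G x w" w]
      x w xc wc coset_commutator by simp_all
  note P = Q.commutator_pow[OF coset_closed[OF x] coset_closed[OF w] *, of m]
  show "H #> commutator G (x [^] m) w = H #> (commutator G x w [^] m)"
    "H #> commutator G x (w [^] m) = H #> (commutator G x w [^] m)"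
    using P x w by (simp_all only: coset_commutator coset_pow nat_pow_closed commutator_closed)
qed

lemma commutator_commutator_mod:
  assumes u: "u \<in> carrier G" and g: "g \<in> carrier G" and w: "w \<in> carrier G"
    and cw: "commutator G (commutator G u g) w \<in> H"
    and dg: "commutator G (commutator G u w) g \<in> H"
    and cd: "commutator G (commutator G u g) (commutator G u w) \<in> H"
  shows "commutator G u (commutator G (inv g) (inv w)) \<in> H"
proof -
  interpret Q: group "G Mod H" by (rule factorgroup_is_group)
  interpret h: group_hom G "G Mod H" "(#>) H" by (rule coset_hom)
  have *: "H #> commutator G (inv g) (inv w) =
      commutator (G Mod H) (inv\<^bsub>G Mod H\<^esub> (H #> g)) (inv\<^bsub>G Mod H\<^esub> (H #> w))"
    using g w by (simp add: coset_commutator del: h.hom_inv) (simp add: h.hom_inv)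
  have "(H #> u) \<otimes>\<^bsub>G Mod H\<^esub> (H #> commutator G (inv g) (inv w)) =
      (H #> commutator G (inv g) (inv w)) \<otimes>\<^bsub>G Mod H\<^esub> (H #> u)"
    unfolding *
    by (rule Q.commute_with_commutator)
      (use u g w cw dg cd coset_commute_iff[of "commutator G u g" w]
        coset_commute_iff[of "commutator G u w" g]
        coset_commute_iff[of "commutator G u g" "commutator G u w"] coset_commutator coset_closed
        in \<open>simp_all\<close>)
  then show ?thesis using coset_commute_iff u g w by simp
qed

end

section \<open>Topological and profinite groups\<close>

text \<open>A form of the tube lemma: the complement is the projection of a closed set along a
  compact factor, and such projections are closed maps.\<close>

lemma openin_forall_compact:
  assumes S: "compact_space S" and W: "openin (prod_topology S T) W"
  shows "openin T {y \<in> topspace T. \<forall>x\<in>topspace S. (x, y) \<in> W}"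
proof -
  let ?C = "topspace S \<times> topspace T - W"
  have "closedin (prod_topology S T) ?C"
    using W by (metis closedin_diff closedin_topspace topspace_prod_topology)
  then have "closedin T (snd ` ?C)"
    using closed_map_snd[OF S] by (auto simp: closed_map_def)
  moreover have "{y \<in> topspace T. \<forall>x\<in>topspace S. (x, y) \<in> W} = topspace T - snd ` ?C"
  proof (intro equalityI subsetI)
    fix y assume "y \<in> topspace T - snd ` ?C"
    moreover from this have "(x, y) \<in> W" if "x \<in> topspace S" for x
      using that image_eqI[of y snd "(x, y)" ?C] by auto
    ultimately show "y \<in> {y \<in> topspace T. \<forall>x\<in>topspace S. (x, y) \<in> W}" by simp
  qed auto
  ultimately show ?thesis by (simp add: openin_diff)
qed

context topological_group
begin

lemma continuous_map_mult:
  assumes "continuous_map Z T f" "continuous_map Z T g"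
  shows "continuous_map Z T (\<lambda>z. f z \<otimes> g z)"
proof -
  have "continuous_map Z T ((\<lambda>(x, y). x \<otimes> y) \<circ> (\<lambda>z. (f z, g z)))"
    using assms by (intro continuous_map_compose[OF _ mult_continuous]) (simp add: continuous_map_paired)
  then show ?thesis by (simp add: o_def)
qed

lemma continuous_map_inv:
  assumes "continuous_map Z T f"
  shows "continuous_map Z T (\<lambda>z. inv (f z))"
  using continuous_map_compose[OF assms inv_continuous] by (simp add: o_def)

lemma continuous_map_group_const: "a \<in> carrier G \<Longrightarrow> continuous_map Z T (\<lambda>_. a)"
  by (simp add: topspace_eq)

lemmas continuous_map_group =
  continuous_map_mult continuous_map_inv continuous_map_group_const continuous_map_id[unfolded id_def]

lemma continuous_map_commutator:
  assumes "continuous_map Z T f" "continuous_map Z T g"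
  shows "continuous_map Z T (\<lambda>z. commutator G (f z) (g z))"
  using assms unfolding commutator_def by (intro continuous_map_group)

lemma closed_subset_carrier: "closedin T C \<Longrightarrow> C \<subseteq> carrier G"
  using closedin_subset topspace_eq by blast

lemma closedin_preimage:
  "\<lbrakk>continuous_map T T f; closedin T C\<rbrakk> \<Longrightarrow> closedin T {x \<in> carrier G. f x \<in> C}"
  using closedin_continuous_map_preimage[of T T f C] by (simp add: topspace_eq)

lemma openin_preimage:
  "\<lbrakk>continuous_map T T f; openin T U\<rbrakk> \<Longrightarrow> openin T {x \<in> carrier G. f x \<in> U}"
  using openin_continuous_map_preimage[of T T f U] by (simp add: topspace_eq)

lemma r_coset_preimage:
  assumes "a \<in> carrier G" "C \<subseteq> carrier G"
  shows "C #> a = {x \<in> carrier G. x \<otimes> inv a \<in> C}"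
proof (intro equalityI subsetI)
  fix x assume "x \<in> C #> a"
  then show "x \<in> {x \<in> carrier G. x \<otimes> inv a \<in> C}"
    using assms by (auto simp: r_coset_def m_assoc subsetD)
next
  fix x assume "x \<in> {x \<in> carrier G. x \<otimes> inv a \<in> C}"
  then show "x \<in> C #> a"
    unfolding r_coset_def using assms by (intro UN_I[of "x \<otimes> inv a"]) (auto simp: m_assoc)
qed

lemma openin_r_coset: "\<lbrakk>a \<in> carrier G; openin T U\<rbrakk> \<Longrightarrow> openin T (U #> a)"
  using openin_subset[of T U] topspace_eq
  by (simp add: r_coset_preimage) (intro openin_preimage continuous_map_group; simp)

lemma closedin_r_coset: "\<lbrakk>a \<in> carrier G; closedin T C\<rbrakk> \<Longrightarrow> closedin T (C #> a)"
  using closed_subset_carrier[of C]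
  by (simp add: r_coset_preimage) (intro closedin_preimage continuous_map_group; simp)

lemma openin_subgroup:
  assumes H: "subgroup H G" and U: "openin T U" "\<one> \<in> U" "U \<subseteq> H"
  shows "openin T H"
proof -
  have "openin T (\<Union>h\<in>H. U #> h)"
    using U subgroup.mem_carrier[OF H] by (intro openin_Union) (auto intro: openin_r_coset)
  moreover have "(\<Union>h\<in>H. U #> h) = H"
  proof
    show "(\<Union>h\<in>H. U #> h) \<subseteq> H"
      using U H by (auto simp: r_coset_def intro!: subgroup.m_closed[OF H])
    show "H \<subseteq> (\<Union>h\<in>H. U #> h)"
      using U subgroup.mem_carrier[OF H] by (force simp: r_coset_def)
  qed
  ultimately show ?thesis by simp
qed

text \<open>Used in both directions: open subgroups are closed because the other cosets are open,
  and closed subgroups of finite index are open because finitely many closed cosets remain.\<close>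

lemma subgroup_coset_cover:
  assumes H: "subgroup H G"
  shows "carrier G - H = \<Union>{C \<in> rcosets H. C \<noteq> H}"
proof (intro equalityI subsetI)
  fix x assume x: "x \<in> carrier G - H"
  then have "x \<in> H #> x" using H by (auto intro: rcos_self)
  moreover have "H #> x \<in> rcosets H" using x H by (simp add: rcosetsI subgroup.subset)
  ultimately show "x \<in> \<Union>{C \<in> rcosets H. C \<noteq> H}" using x by blast
next
  fix x assume "x \<in> \<Union>{C \<in> rcosets H. C \<noteq> H}"
  then obtain C where C: "C \<in> rcosets H" "C \<noteq> H" "x \<in> C" by auto
  have "x \<in> carrier G" using C H by (metis UnionI rcosets_part_G)
  moreover have "H \<in> rcosets H" using H is_group by (rule subgroup.subgroup_in_rcosets)
  then have "C \<inter> H = {}" using C rcos_disjoint[OF H] by (auto simp: pairwise_def disjnt_def)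
  ultimately show "x \<in> carrier G - H" using C by auto
qed

lemma closedin_open_subgroup:
  assumes H: "subgroup H G" and "openin T H"
  shows "closedin T H"
proof -
  have "openin T (carrier G - H)"
    unfolding subgroup_coset_cover[OF H]
    by (intro openin_Union) (auto simp: RCOSETS_def intro: openin_r_coset assms)
  then show ?thesis
    using H by (simp add: closedin_def topspace_eq subgroup.subset)
qed

lemma openin_closed_finite_index:
  assumes H: "subgroup H G" "closedin T H" "finite (rcosets H)"
  shows "openin T H"
proof -
  have "closedin T (carrier G - H)"
    unfolding subgroup_coset_cover[OF H(1)]
  proof (rule closedin_Union)
    show "finite {C \<in> rcosets H. C \<noteq> H}" using H(3) by simp
  qed (auto simp: RCOSETS_def intro: closedin_r_coset H(2))
  then have "openin T (carrier G - (carrier G - H))"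
    using topspace_eq by (metis openin_diff openin_topspace)
  then show ?thesis
    using subgroup.subset[OF H(1)] by (simp add: double_diff)
qed

section \<open>Closed subgroups generated by a set\<close>

lemma csg_closed_subgroup:
  assumes "S \<subseteq> carrier G"
  shows "subgroup (closed_subgroup_generated G T S) G" "closedin T (closed_subgroup_generated G T S)"
proof -
  let ?F = "{H. (subgroup H G \<and> closedin T H) \<and> S \<subseteq> H}"
  have "carrier G \<in> ?F"
    using assms subgroup_self closedin_topspace[of T] by (simp add: topspace_eq)
  then have ne: "?F \<noteq> {}" by blast
  show "subgroup (closed_subgroup_generated G T S) G"
    unfolding closed_subgroup_generated_def hull_def by (rule subgroups_Inter) (use ne in auto)
  show "closedin T (closed_subgroup_generated G T S)"
    unfolding closed_subgroup_generated_def hull_def by (rule closedin_Inter) (use ne in auto)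
qed

lemma csg_minimal:
  "\<lbrakk>S \<subseteq> H; subgroup H G; closedin T H\<rbrakk> \<Longrightarrow> closed_subgroup_generated G T S \<subseteq> H"
  unfolding closed_subgroup_generated_def by (rule hull_minimal) auto

lemma csg_superset: "S \<subseteq> closed_subgroup_generated G T S"
  unfolding closed_subgroup_generated_def by (rule hull_subset)

lemma csg_normal:
  assumes S: "S \<subseteq> carrier G" and inv: "\<And>g s. \<lbrakk>g \<in> carrier G; s \<in> S\<rbrakk> \<Longrightarrow> g \<otimes> s \<otimes> inv g \<in> S"
  shows "closed_subgroup_generated G T S \<lhd> G"
proof (rule normal_invI)
  let ?N = "closed_subgroup_generated G T S"
  show N: "subgroup ?N G" using csg_closed_subgroup[OF S] by simp
  fix g h assume g: "g \<in> carrier G" and h: "h \<in> ?N"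
  \<comment> \<open>For fixed \<open>g\<close> the elements that \<open>g\<close> conjugates into
    \<open>?N\<close> form a closed subgroup containing \<open>S\<close>, so minimality of
    \<open>?N\<close> applies.\<close>
  have "?N \<subseteq> {x \<in> carrier G. g \<otimes> x \<otimes> inv g \<in> ?N}"
  proof (rule csg_minimal)
    show "S \<subseteq> {x \<in> carrier G. g \<otimes> x \<otimes> inv g \<in> ?N}"
      using S inv[OF g] csg_superset by blast
    show "closedin T {x \<in> carrier G. g \<otimes> x \<otimes> inv g \<in> ?N}"
      using g csg_closed_subgroup[OF S] by (intro closedin_preimage continuous_map_group) auto
    show "subgroup {x \<in> carrier G. g \<otimes> x \<otimes> inv g \<in> ?N} G"
    proof (rule subgroupI)
      show "{x \<in> carrier G. g \<otimes> x \<otimes> inv g \<in> ?N} \<noteq> {}"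
        using g N by (auto intro!: exI[of _ \<one>] simp: subgroup.one_closed)
    next
      fix a assume "a \<in> {x \<in> carrier G. g \<otimes> x \<otimes> inv g \<in> ?N}"
      moreover from this have "g \<otimes> inv a \<otimes> inv g = inv (g \<otimes> a \<otimes> inv g)"
        using g by (simp add: inv_mult_group m_assoc)
      ultimately show "inv a \<in> {x \<in> carrier G. g \<otimes> x \<otimes> inv g \<in> ?N}"
        using N by (simp add: subgroup.m_inv_closed)
    next
      fix a b assume "a \<in> {x \<in> carrier G. g \<otimes> x \<otimes> inv g \<in> ?N}" "b \<in> {x \<in> carrier G. g \<otimes> x \<otimes> inv g \<in> ?N}"
      moreover from this have "g \<otimes> (a \<otimes> b) \<otimes> inv g = (g \<otimes> a \<otimes> inv g) \<otimes> (g \<otimes> b \<otimes> inv g)"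
        using g by (simp add: m_assoc)
      ultimately show "a \<otimes> b \<in> {x \<in> carrier G. g \<otimes> x \<otimes> inv g \<in> ?N}"
        using N by (simp add: subgroup.m_closed)
    qed auto
  qed
  then show "g \<otimes> h \<otimes> inv g \<in> ?N" using h by blast
qed

section \<open>Closed normal and open normal subgroups\<close>

definition closed_normal :: "'a set \<Rightarrow> bool" where
  "closed_normal N \<longleftrightarrow> N \<lhd> G \<and> closedin T N"

definition open_normal :: "'a set \<Rightarrow> bool" where
  "open_normal N \<longleftrightarrow> N \<lhd> G \<and> openin T N"

lemma open_normal_imp_closed_normal: "open_normal N \<Longrightarrow> closed_normal N"
  unfolding open_normal_def closed_normal_def
  using closedin_open_subgroup normal_imp_subgroup by blast

lemma closed_normalD:
  assumes "closed_normal N"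
  shows "N \<lhd> G" "closedin T N" "subgroup N G" "N \<subseteq> carrier G" "\<one> \<in> N"
  using assms unfolding closed_normal_def
  by (auto dest: normal_imp_subgroup subgroup.mem_carrier subgroup.one_closed)

lemma open_normalD:
  assumes "open_normal N"
  shows "N \<lhd> G" "openin T N" "closedin T N" "subgroup N G" "N \<subseteq> carrier G" "\<one> \<in> N"
  using assms closed_normalD[OF open_normal_imp_closed_normal[OF assms]] unfolding open_normal_def
  by auto

lemma closed_normal_carrier: "closed_normal (carrier G)"
  unfolding closed_normal_def
  using closedin_topspace[of T] by (auto simp: topspace_eq normal_inv_iff subgroup_self)

lemma closed_normal_Inter:
  "\<lbrakk>\<F> \<noteq> {}; \<And>N. N \<in> \<F> \<Longrightarrow> closed_normal N\<rbrakk> \<Longrightarrow> closed_normal (\<Inter>\<F>)"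
  unfolding closed_normal_def by (auto intro!: normal_Inter closedin_Inter)

lemma closed_normal_Int: "\<lbrakk>closed_normal A; closed_normal B\<rbrakk> \<Longrightarrow> closed_normal (A \<inter> B)"
  using closed_normal_Inter[of "{A, B}"] by auto

lemma open_normal_Int: "\<lbrakk>open_normal A; open_normal B\<rbrakk> \<Longrightarrow> open_normal (A \<inter> B)"
  unfolding open_normal_def by (auto intro: normal_subgroup_intersect)

lemma open_normal_superset:
  "\<lbrakk>open_normal U; N \<lhd> G; U \<subseteq> N\<rbrakk> \<Longrightarrow> open_normal N"
  unfolding open_normal_def
  using openin_subgroup[of N U] normal_imp_subgroup[of N] normal_imp_subgroup[of U] subgroup.one_closed[of U]
  by blast

lemma open_normal_set_mult:
  assumes "N \<lhd> G" "open_normal U"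
  shows "open_normal (N <#> U)"
  using assms set_mult_upper[of N U] open_normal_superset[of U "N <#> U"] normal_set_mult_normal[of N U]
  by (auto dest: normal_imp_subgroup open_normalD)

end

section \<open>Compactness arguments and the supply of open normal subgroups\<close>

context profinite_group
begin

text \<open>Multiplication is continuous from a compact space to a Hausdorff space, hence a closed
  map.\<close>

lemma closedin_set_mult:
  assumes "closedin T A" "closedin T B"
  shows "closedin T (A <#> B)"
proof -
  have "closed_map (prod_topology T T) T (\<lambda>(x, y). x \<otimes> y)"
    by (intro continuous_imp_closed_map mult_continuous Hausdorff)
      (simp add: compact_space_prod_topology compact)
  then have "closedin T ((\<lambda>(x, y). x \<otimes> y) ` (A \<times> B))"
    using assms unfolding closed_map_def by (simp add: closedin_prod_Times_iff)
  moreover have "(\<lambda>(x, y). x \<otimes> y) ` (A \<times> B) = A <#> B" by (auto simp: set_mult_def)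
  ultimately show ?thesis by simp
qed

lemma closed_normal_set_mult:
  "\<lbrakk>closed_normal A; closed_normal B\<rbrakk> \<Longrightarrow> closed_normal (A <#> B)"
  by (simp add: closed_normal_def normal_set_mult_normal closedin_set_mult)

lemma finite_rcosets_open:
  assumes H: "subgroup H G" "openin T H"
  shows "finite (rcosets H)"
proof -
  have "\<exists>\<F>. finite \<F> \<and> \<F> \<subseteq> rcosets H \<and> topspace T \<subseteq> \<Union>\<F>"
    using compact unfolding compact_space_alt
    using rcosets_part_G[OF H(1)] H openin_r_coset by (auto simp: topspace_eq RCOSETS_def)
  then obtain \<F> where F: "finite \<F>" "\<F> \<subseteq> rcosets H" "carrier G \<subseteq> \<Union>\<F>"
    by (auto simp: topspace_eq)
  have "rcosets H \<subseteq> \<F>"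
  proof
    fix C assume C: "C \<in> rcosets H"
    then obtain x where x: "x \<in> C" "x \<in> carrier G"
      using H(1) by (metis UnionI all_not_in_conv rcosets_part_G subgroup.rcosets_non_empty)
    then obtain D where D: "D \<in> \<F>" "x \<in> D" using F by blast
    then have "C = D"
      using pairwiseD[OF rcos_disjoint[OF H(1)], of C D] C x F(2) by (auto simp: disjnt_iff)
    then show "C \<in> \<F>" using D by simp
  qed
  then show ?thesis using F finite_subset by blast
qed

lemma openin_forall:
  assumes "openin (prod_topology T T) W"
  shows "openin T {y \<in> carrier G. \<forall>x\<in>carrier G. (x, y) \<in> W}"
  using openin_forall_compact[OF compact assms] by (simp add: topspace_eq)

lemma normal_core:
  assumes S: "subgroup S G" "openin T S"
  obtains N where "open_normal N" "N \<subseteq> S"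
proof
  \<comment> \<open>The intersection of all conjugates of \<open>S\<close>. It is open by the tube
    lemma, since the conjugating element ranges over a compact space.\<close>
  define N where "N = {y \<in> carrier G. \<forall>g\<in>carrier G. g \<otimes> y \<otimes> inv g \<in> S}"
  have "openin (prod_topology T T) {z \<in> topspace (prod_topology T T). fst z \<otimes> snd z \<otimes> inv (fst z) \<in> S}"
    by (intro openin_continuous_map_preimage[OF _ S(2)] continuous_map_group continuous_map_fst continuous_map_snd)
  from openin_forall[OF this] have "openin T N"
    unfolding N_def by (simp add: topspace_eq cong: conj_cong)
  moreover have "N \<lhd> G"
  proof (rule normal_invI)
    show "subgroup N G"
    proof (rule subgroupI)
      show "N \<noteq> {}" using S by (auto simp: N_def subgroup.one_closed intro!: exI[of _ \<one>])
      fix a assume a: "a \<in> N"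
      then have "g \<otimes> inv a \<otimes> inv g \<in> S" if "g \<in> carrier G" for g
      proof -
        have "inv (g \<otimes> a \<otimes> inv g) = g \<otimes> inv a \<otimes> inv g"
          using a that by (simp add: N_def inv_mult_group m_assoc)
        then show ?thesis
          using subgroup.m_inv_closed[OF S(1), of "g \<otimes> a \<otimes> inv g"] a that by (simp add: N_def)
      qed
      then show "inv a \<in> N" using a by (simp add: N_def)
      fix b assume b: "b \<in> N"
      have "g \<otimes> (a \<otimes> b) \<otimes> inv g \<in> S" if "g \<in> carrier G" for g
      proof -
        have "(g \<otimes> a \<otimes> inv g) \<otimes> (g \<otimes> b \<otimes> inv g) = g \<otimes> (a \<otimes> b) \<otimes> inv g"
          using a b that by (simp add: N_def m_assoc)
        then show ?thesis
          using subgroup.m_closed[OF S(1), of "g \<otimes> a \<otimes> inv g" "g \<otimes> b \<otimes> inv g"] a b that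
          by (simp add: N_def)
      qed
      then show "a \<otimes> b \<in> N" using a b by (simp add: N_def)
    qed (auto simp: N_def)
    fix x h assume x: "x \<in> carrier G" and h: "h \<in> N"
    have "g \<otimes> (x \<otimes> h \<otimes> inv x) \<otimes> inv g = (g \<otimes> x) \<otimes> h \<otimes> inv (g \<otimes> x)" if "g \<in> carrier G" for g
      using that x h by (simp add: N_def m_assoc inv_mult_group)
    then show "x \<otimes> h \<otimes> inv x \<in> N" using x h by (simp add: N_def)
  qed
  ultimately show "open_normal N" by (simp add: open_normal_def)
  show "N \<subseteq> S" by (auto simp: N_def dest: bspec[of _ _ \<one>])
qed

text \<open>The elements \<open>y\<close> with \<open>V y\<close> inside \<open>V\<close> form an
  open set by the tube lemma, as \<open>V\<close> is clopen. Those for which \<open>inv y\<close>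
  has the same property form a subgroup, and it lies in \<open>V\<close> because
  \<open>\<one> \<in> V\<close>.\<close>

lemma clopen_contains_open_subgroup:
  assumes V: "openin T V" "closedin T V" "\<one> \<in> V"
  obtains S where "subgroup S G" "openin T S" "S \<subseteq> V"
proof
  \<comment> \<open>The implication from \<open>x \<in> V\<close> to
    \<open>x \<otimes> y \<in> V\<close>, written as a union of two open sets; the first is open
    because \<open>V\<close> is closed.\<close>
  define W where "W = {z \<in> topspace (prod_topology T T). fst z \<in> carrier G - V} \<union>
      {z \<in> topspace (prod_topology T T). fst z \<otimes> snd z \<in> V}"
  have "openin T (carrier G - V)" using V by (metis openin_diff openin_topspace topspace_eq)
  then have W: "openin (prod_topology T T) W"
    unfolding W_def using V
    by (intro openin_Un openin_continuous_map_preimage[of _ T] continuous_map_group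
        continuous_map_fst continuous_map_snd)
  define A where "A = {y \<in> carrier G. \<forall>x\<in>carrier G. (x, y) \<in> W}"
  have A_iff: "y \<in> A \<longleftrightarrow> y \<in> carrier G \<and> (\<forall>v\<in>V. v \<otimes> y \<in> V)" for y
    using closed_subset_carrier[OF V(2)] by (auto simp: A_def W_def topspace_eq)
  have "openin T A" unfolding A_def by (rule openin_forall[OF W])
  then have "openin T (A \<inter> {y \<in> carrier G. inv y \<in> A})"
    by (intro openin_Int openin_preimage continuous_map_group)
  moreover define S where "S = A \<inter> {y \<in> carrier G. inv y \<in> A}"
  ultimately show "openin T S" by simp
  show "S \<subseteq> V" using A_iff V(3) by (auto simp: S_def) (metis l_one)
  show "subgroup S G"
  proof (rule subgroupI)
    show "S \<noteq> {}" using closed_subset_carrier[OF V(2)] by (auto simp: S_def A_iff subset_iff set_eq_iff intro!: exI[of _ \<one>])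
    show "a \<otimes> b \<in> S" if "a \<in> S" "b \<in> S" for a b
      using that closed_subset_carrier[OF V(2)]
      by (auto simp: S_def A_iff inv_mult_group subset_iff simp flip: m_assoc)
  qed (auto simp: S_def A_iff)
qed

text \<open>In a compact Hausdorff space components and quasi-components coincide, so total
  disconnectedness yields a clopen set containing \<open>\<one>\<close> but not \<open>x\<close>;
  shrink it to a subgroup and then to its normal core.\<close>

lemma open_normal_separating:
  assumes x: "x \<in> carrier G" "x \<noteq> \<one>"
  obtains N where "open_normal N" "x \<notin> N"
proof -
  have "\<not> connected_component_of T \<one> x"
    using totally_disconnected x unfolding totally_disconnected_space_def connected_component_of_def
    by metis
  then have "\<not> quasi_component_of T \<one> x"
    using quasi_eq_connected_component_of[of T \<one>] compact Hausdorff by metis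
  then obtain V where V: "closedin T V" "openin T V" "\<one> \<in> V" "x \<notin> V"
    using x by (auto simp: quasi_component_of topspace_eq)
  obtain S where S: "subgroup S G" "openin T S" "S \<subseteq> V"
    using clopen_contains_open_subgroup V by metis
  obtain N where "open_normal N" "N \<subseteq> S" using normal_core[OF S(1,2)] .
  then show thesis using that S V by blast
qed

lemma closedin_one: "closedin T {\<one>}"
  using Hausdorff by (simp add: closedin_Hausdorff_singleton topspace_eq)

lemma closed_normal_one: "closed_normal {\<one>}"
  by (simp add: closed_normal_def closedin_one one_is_normal)

lemma open_normal_carrier: "open_normal (carrier G)"
  using closed_normal_carrier openin_topspace[of T] by (simp add: open_normal_def closed_normal_def topspace_eq)

lemma open_normal_not_superset:
  assumes "closed_normal K" "K \<noteq> {\<one>}"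
  obtains H where "open_normal H" "\<not> K \<subseteq> H"
proof -
  obtain x where "x \<in> K" "x \<noteq> \<one>" using assms closed_normalD(5)[of K] by blast
  then show thesis
    using open_normal_separating[of x] that closed_normalD(4)[OF assms(1)] by blast
qed

lemma Inter_set_mult_decseq:
  fixes V :: "nat \<Rightarrow> 'a set"
  assumes A: "closed_normal A" and V: "\<And>i. closed_normal (V i)" "decseq V"
  shows "(\<Inter>i. A <#> V i) \<subseteq> A <#> (\<Inter>i. V i)"
proof
  fix x assume x: "x \<in> (\<Inter>i. A <#> V i)"
  have cA: "A \<subseteq> carrier G" "\<And>i. V i \<subseteq> carrier G" using A V closed_normalD(4) by auto
  have xc: "x \<in> carrier G" using x cA setmult_subset_G[OF cA(1) cA(2)] by blast
  \<comment> \<open>The possible second factors of \<open>x\<close> at stage \<open>i\<close>. These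
    sets are closed, non-empty and decreasing, so by compactness one factor works at all
    stages.\<close>
  define C where "C i = V i \<inter> {v \<in> carrier G. x \<otimes> inv v \<in> A}" for i
  have "(\<Inter>i. C i) \<noteq> {}"
  proof (rule compact_space_imp_nest[OF compact])
    show "closedin T (C i)" for i
      unfolding C_def using A V xc
      by (intro closedin_Int closedin_preimage continuous_map_group) (auto dest: closed_normalD)
    show "decseq C" using V(2) unfolding C_def decseq_def by blast
    show "C i \<noteq> {}" for i
    proof -
      obtain a v where av: "a \<in> A" "v \<in> V i" "x = a \<otimes> v"
        using x by (auto simp: mem_set_mult dest!: spec[of _ i])
      then have "x \<otimes> inv v = a" using cA by (simp add: m_assoc subset_iff)
      then have "v \<in> C i" using av cA by (auto simp: C_def)
      then show ?thesis by blast
    qed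
  qed
  then obtain v where v: "v \<in> carrier G" "\<And>i. v \<in> V i" "x \<otimes> inv v \<in> A" by (auto simp: C_def)
  then have "x = (x \<otimes> inv v) \<otimes> v" using xc by (simp add: m_assoc)
  then show "x \<in> A <#> (\<Inter>i. V i)" using v by (auto simp: mem_set_mult)
qed

text \<open>Zorn's lemma for reverse inclusion. The intersection of a chain still leaves
  \<open>H\<close>: since \<open>H\<close> is open, the sets \<open>L - H\<close> are closed, and
  the finite intersection property applies.\<close>

lemma minimal_closed_normal_not_subset:
  assumes K: "closed_normal K" and H: "openin T H" "\<not> K \<subseteq> H"
  obtains L where "closed_normal L" "L \<subseteq> K" "\<not> L \<subseteq> H"
    "\<And>M. \<lbrakk>closed_normal M; M \<subseteq> L; M \<noteq> L\<rbrakk> \<Longrightarrow> M \<subseteq> H"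
proof -
  define \<A> where "\<A> = {L. closed_normal L \<and> L \<subseteq> K \<and> \<not> L \<subseteq> H}"
  have "\<exists>m\<in>\<A>. \<forall>a\<in>\<A>. m \<supseteq> a \<longrightarrow> a = m"
  proof (rule predicate_Zorn)
    show "partial_order_on \<A> (relation_of (\<supseteq>) \<A>)"
      by (auto simp: partial_order_on_def preorder_on_def relation_of_def refl_on_def trans_def antisym_def)
    fix \<C> assume "\<C> \<in> Chains (relation_of (\<supseteq>) \<A>)"
    then have sub: "\<C> \<subseteq> \<A>" and chain: "\<And>A B. \<lbrakk>A \<in> \<C>; B \<in> \<C>\<rbrakk> \<Longrightarrow> A \<subseteq> B \<or> B \<subseteq> A"
      by (auto simp: Chains_def relation_of_def)
    show "\<exists>u\<in>\<A>. \<forall>a\<in>\<C>. a \<supseteq> u"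
    proof (cases "\<C> = {}")
      case True
      then show ?thesis using K H by (auto simp: \<A>_def)
    next
      case False
      have cl: "closed_normal L" "\<not> L \<subseteq> H" if "L \<in> \<C>" for L using that sub by (auto simp: \<A>_def)
      have "\<Inter>((\<lambda>L. L - H) ` \<C>) \<noteq> {}"
      proof (rule compact_space_fip[THEN iffD1, OF compact, rule_format], intro conjI ballI allI impI)
        fix C assume "C \<in> (\<lambda>L. L - H) ` \<C>"
        then show "closedin T C" using cl H by (auto intro: closedin_diff closed_normalD)
      next
        fix \<F> assume "finite \<F> \<and> \<F> \<subseteq> (\<lambda>L. L - H) ` \<C>"
        then obtain \<D> where D: "finite \<D>" "\<D> \<subseteq> \<C>" "\<F> = (\<lambda>L. L - H) ` \<D>"
          using finite_subset_image[of \<F> "\<lambda>L. L - H" \<C>] by blast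
        show "\<Inter>\<F> \<noteq> {}"
        proof (cases "\<D> = {}")
          case False
          from D(1) False D(2) have "\<exists>m\<in>\<D>. \<forall>L\<in>\<D>. m \<subseteq> L"
          proof (induction \<D> rule: finite_ne_induct)
            case (insert A \<D>)
            then obtain m where m: "m \<in> \<D>" "\<forall>L\<in>\<D>. m \<subseteq> L" by blast
            have "A \<subseteq> m \<or> m \<subseteq> A" by (rule chain) (use m insert.prems in auto)
            then show ?case
            proof
              assume "A \<subseteq> m"
              then show ?thesis using m by (intro bexI[of _ A]) auto
            next
              assume "m \<subseteq> A"
              then show ?thesis using m by (intro bexI[of _ m]) auto
            qed
          qed auto
          then obtain m where m: "m \<in> \<D>" "\<forall>L\<in>\<D>. m \<subseteq> L" by blast
          then obtain x where "x \<in> m" "x \<notin> H" using cl D(2) by blast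
          then have "x \<in> \<Inter>\<F>" using m D(3) by auto
          then show ?thesis by blast
        qed (use D in auto)
      qed
      then have "\<not> \<Inter>\<C> \<subseteq> H" using False by auto
      moreover have "closed_normal (\<Inter>\<C>)" using cl False by (intro closed_normal_Inter) auto
      moreover have "\<Inter>\<C> \<subseteq> K" using False sub by (auto simp: \<A>_def)
      ultimately show ?thesis by (auto simp: \<A>_def)
    qed
  qed
  then obtain L where L: "L \<in> \<A>" "\<And>M. \<lbrakk>M \<in> \<A>; M \<subseteq> L\<rbrakk> \<Longrightarrow> M = L" by blast
  show thesis
  proof (rule that)
    fix M assume "closed_normal M" "M \<subseteq> L" "M \<noteq> L"
    then show "M \<subseteq> H" using L by (auto simp: \<A>_def)
  qed (use L(1) in \<open>auto simp: \<A>_def\<close>)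
qed

end

section \<open>Commutator subgroups and central series\<close>

context group
begin

text \<open>The set is the preimage of the centralizer of the image of \<open>S\<close> in
  \<open>G Mod K\<close>. Allowing an arbitrary set \<open>S\<close> permits singletons later
  on.\<close>

lemma subgroup_Collect_centralize:
  assumes K: "K \<lhd> G" and S: "S \<subseteq> carrier G"
  shows "subgroup {x \<in> carrier G. \<forall>w\<in>S. commutator G x w \<in> K} G"
proof (rule subgroupI)
  interpret normal K G by fact
  let ?C = "{x \<in> carrier G. \<forall>w\<in>S. commutator G x w \<in> K}"
  show "?C \<noteq> {}"
    using S by (auto simp: commutator_def subset_iff intro!: exI[of _ \<one>])
  fix x assume x: "x \<in> ?C"
  show "inv x \<in> ?C"
    using x S inv_op_closed2[of x] by (auto simp: commutator_inv_left subset_iff)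
  fix y assume y: "y \<in> ?C"
  show "x \<otimes> y \<in> ?C"
    using x y S inv_op_closed1[of y] by (auto simp: commutator_mult_left subset_iff)
qed auto

lemma normal_Collect_centralize:
  assumes K: "K \<lhd> G" and S: "S \<lhd> G"
  shows "{x \<in> carrier G. \<forall>w\<in>S. commutator G x w \<in> K} \<lhd> G"
proof (rule normal_invI)
  have sub: "S \<subseteq> carrier G" using S by (auto dest: normal_imp_subgroup subgroup.mem_carrier)
  show "subgroup {x \<in> carrier G. \<forall>w\<in>S. commutator G x w \<in> K} G"
    by (rule subgroup_Collect_centralize[OF K sub])
  fix g x assume "g \<in> carrier G" "x \<in> {x \<in> carrier G. \<forall>w\<in>S. commutator G x w \<in> K}"
  then show "g \<otimes> x \<otimes> inv g \<in> {x \<in> carrier G. \<forall>w\<in>S. commutator G x w \<in> K}"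
    using sub normal.inv_op_closed1[OF S] normal.inv_op_closed2[OF K]
    by (auto simp: commutator_conj_left subset_iff)
qed

lemma commutator_mem_swap:
  assumes "subgroup K G" "x \<in> carrier G" "y \<in> carrier G"
  shows "commutator G y x \<in> K \<longleftrightarrow> commutator G x y \<in> K"
  using assms commutator_swap[of x y] commutator_swap[of y x]
  by (metis subgroup.m_inv_closed)

text \<open>For normal subgroups \<open>K \<subseteq> W\<close> the intersection of the
  \<open>i\<close>-th term with \<open>W\<close> is the preimage of the \<open>i\<close>-th centre
  of \<open>W / K\<close>. Elements range over all of \<open>G\<close>, so a term need not lie in
  \<open>W\<close>.\<close>

primrec upper_central :: "'a set \<Rightarrow> 'a set \<Rightarrow> nat \<Rightarrow> 'a set" where
  "upper_central K W 0 = K"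
| "upper_central K W (Suc i) = {x \<in> carrier G. \<forall>w\<in>W. commutator G x w \<in> upper_central K W i}"

end

context topological_group
begin

lemma closedin_Collect_centralize:
  assumes "closedin T K" "S \<subseteq> carrier G"
  shows "closedin T {x \<in> carrier G. \<forall>w\<in>S. commutator G x w \<in> K}"
proof (cases "S = {}")
  case True
  then show ?thesis using closedin_topspace[of T] by (simp add: topspace_eq)
next
  case False
  have "closedin T {x \<in> carrier G. commutator G x w \<in> K}" if "w \<in> S" for w
    using that assms by (intro closedin_preimage continuous_map_commutator continuous_map_group) auto
  then have "closedin T (\<Inter>w\<in>S. {x \<in> carrier G. commutator G x w \<in> K})"
    using False by (intro closedin_INT) auto
  moreover have "(\<Inter>w\<in>S. {x \<in> carrier G. commutator G x w \<in> K}) =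
      {x \<in> carrier G. \<forall>w\<in>S. commutator G x w \<in> K}" using False by auto
  ultimately show ?thesis by simp
qed

lemma closed_normal_Collect_centralize:
  assumes "closed_normal K" "S \<lhd> G"
  shows "closed_normal {x \<in> carrier G. \<forall>w\<in>S. commutator G x w \<in> K}"
  unfolding closed_normal_def
  using assms normal_imp_subgroup[OF assms(2)]
  by (simp add: closedin_Collect_centralize normal_Collect_centralize closed_normalD subgroup.subset)

lemma closed_normal_upper_central:
  "\<lbrakk>closed_normal K; W \<lhd> G\<rbrakk> \<Longrightarrow> closed_normal (upper_central K W i)"
  by (induction i) (simp_all add: closed_normal_Collect_centralize)

lemma commutators_subset_carrier:
  "\<lbrakk>K \<subseteq> carrier G; L \<subseteq> carrier G\<rbrakk> \<Longrightarrow> {commutator G x y | x y. x \<in> K \<and> y \<in> L} \<subseteq> carrier G"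
  by (auto simp: subset_iff)

lemma commutator_subgroup_closed:
  assumes "K \<subseteq> carrier G" "L \<subseteq> carrier G"
  shows "subgroup (commutator_subgroup G T K L) G" "closedin T (commutator_subgroup G T K L)"
  unfolding commutator_subgroup_def
  using csg_closed_subgroup[OF commutators_subset_carrier[OF assms]] by auto

lemma commutator_in_commutator_subgroup:
  "\<lbrakk>x \<in> K; y \<in> L\<rbrakk> \<Longrightarrow> commutator G x y \<in> commutator_subgroup G T K L"
  unfolding commutator_subgroup_def by (rule subsetD[OF csg_superset]) auto

lemma commutator_subgroup_least:
  assumes "subgroup C G" "closedin T C" "\<And>x y. \<lbrakk>x \<in> K; y \<in> L\<rbrakk> \<Longrightarrow> commutator G x y \<in> C"
  shows "commutator_subgroup G T K L \<subseteq> C"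
  unfolding commutator_subgroup_def using assms by (intro csg_minimal) auto

lemma commutator_subgroup_mono:
  "\<lbrakk>K \<subseteq> K'; L \<subseteq> L'\<rbrakk> \<Longrightarrow> commutator_subgroup G T K L \<subseteq> commutator_subgroup G T K' L'"
  unfolding commutator_subgroup_def closed_subgroup_generated_def by (rule hull_mono) auto

lemma closed_normal_commutator_subgroup:
  assumes K: "K \<lhd> G" and L: "L \<lhd> G"
  shows "closed_normal (commutator_subgroup G T K L)"
proof -
  have sub: "K \<subseteq> carrier G" "L \<subseteq> carrier G"
    using assms by (auto dest: normal_imp_subgroup subgroup.mem_carrier)
  have "commutator_subgroup G T K L \<lhd> G"
    unfolding commutator_subgroup_def
  proof (rule csg_normal[OF commutators_subset_carrier[OF sub]], clarify)
    fix g s x y assume g: "g \<in> carrier G" and xy: "x \<in> K" "y \<in> L"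
    have "g \<otimes> commutator G x y \<otimes> inv g = commutator G (g \<otimes> x \<otimes> inv g) (g \<otimes> y \<otimes> inv g)"
      using g xy sub by (simp add: commutator_conj subset_iff)
    then show "\<exists>x' y'. g \<otimes> commutator G x y \<otimes> inv g = commutator G x' y' \<and> x' \<in> K \<and> y' \<in> L"
      using normal.inv_op_closed2[OF K g xy(1)] normal.inv_op_closed2[OF L g xy(2)] by blast
  qed
  then show ?thesis using commutator_subgroup_closed[OF sub] by (simp add: closed_normal_def)
qed

lemma commutator_subgroup_subset:
  assumes "closed_normal K" "L \<subseteq> carrier G"
  shows "commutator_subgroup G T K L \<subseteq> K" "commutator_subgroup G T L K \<subseteq> K"
proof -
  have "commutator G x y \<in> K" "commutator G y x \<in> K" if "x \<in> K" "y \<in> L" for x y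
    using that assms commutator_in_normal[of K x y] closed_normalD(1) by auto
  then show "commutator_subgroup G T K L \<subseteq> K" "commutator_subgroup G T L K \<subseteq> K"
    by (intro commutator_subgroup_least closed_normalD[OF assms(1)]; simp)+
qed

section \<open>The lower central series of a closed normal subgroup\<close>

abbreviation lc :: "nat \<Rightarrow> 'a set \<Rightarrow> 'a set" where
  "lc \<equiv> lower_central G T"

lemma lc_Suc: "1 \<le> i \<Longrightarrow> lc (Suc i) K = commutator_subgroup G T (lc i K) K"
  by (cases i) auto

lemma lc_Suc_induct [case_names one Suc, consumes 1]:
  assumes "1 \<le> i" "P (Suc 0)" "\<And>i. \<lbrakk>1 \<le> i; P i\<rbrakk> \<Longrightarrow> P (Suc i)"
  shows "P i"
  using assms by (induction i rule: nat_induct_at_least) auto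

lemma closed_normal_lc:
  assumes "closed_normal K"
  shows "closed_normal (lc i K)"
proof (cases "1 \<le> i")
  case True
  then show ?thesis
    by (induction rule: lc_Suc_induct)
      (use assms in \<open>auto simp: lc_Suc closed_normalD intro: closed_normal_commutator_subgroup\<close>)
qed (use assms in \<open>auto simp: not_le\<close>)

lemma lc_mono:
  assumes "K \<subseteq> K'"
  shows "lc i K \<subseteq> lc i K'"
proof (cases "1 \<le> i")
  case True
  then show ?thesis
    by (induction rule: lc_Suc_induct) (use assms in \<open>auto simp: lc_Suc dest: commutator_subgroup_mono\<close>)
qed (use assms in \<open>auto simp: not_le\<close>)

lemma lc_Suc_subset:
  assumes "closed_normal K"
  shows "lc (Suc i) K \<subseteq> lc i K"
proof (cases "1 \<le> i")
  case True
  then show ?thesis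
    using assms by (simp add: lc_Suc commutator_subgroup_subset closed_normal_lc closed_normalD)
qed (auto simp: not_le)

lemma lc_antimono:
  assumes "closed_normal K" "i \<le> j"
  shows "lc j K \<subseteq> lc i K"
  using assms(2)
  by (induction rule: dec_induct) (use lc_Suc_subset[OF assms(1)] in auto)

lemma lc_subset: "closed_normal K \<Longrightarrow> lc i K \<subseteq> K"
  using lc_antimono[of K 0 i] by simp

lemma lc_commutator:
  "\<lbrakk>1 \<le> i; x \<in> lc i K; y \<in> K\<rbrakk> \<Longrightarrow> commutator G x y \<in> lc (Suc i) K"
  by (simp add: lc_Suc commutator_in_commutator_subgroup)

text \<open>If the next term were trivial, the current one would commute with \<open>N\<close> and
  in particular with itself: an abelian closed normal subgroup of \<open>G\<close>, non-trivial by
  induction.\<close>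

lemma Fitting_free_lc_nontrivial:
  assumes ff: "Fitting_free G T" and N: "closed_normal N" "N \<noteq> {\<one>}"
  shows "lc i N \<noteq> {\<one>}"
proof (cases "1 \<le> i")
  case True
  then show ?thesis
  proof (induction rule: lc_Suc_induct)
    case (Suc i)
    have L: "closed_normal (lc i N)" using N by (simp add: closed_normal_lc)
    show ?case
    proof
      assume *: "lc (Suc i) N = {\<one>}"
      have "x \<otimes> y = y \<otimes> x" if "x \<in> lc i N" "y \<in> lc i N" for x y
      proof -
        have "y \<in> N" using that lc_subset[OF N(1)] by auto
        then have "commutator G x y = \<one>" using lc_commutator[OF Suc(1) that(1)] * by auto
        then show ?thesis using that closed_normalD(4)[OF L] commutator_eq_one_iff[of x y] by auto
      qed
      then show False using ff L Suc.IH unfolding Fitting_free_def closed_normal_def by blast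
    qed
  qed (use N in auto)
qed (use N in \<open>auto simp: not_le\<close>)

end

section \<open>Virtual nilpotency of quotients, expressed inside the group\<close>

context profinite_group
begin

lemma virtually_nilpotent_iff:
  "virtually_nilpotent c G T \<longleftrightarrow> (\<exists>M. open_normal M \<and> lc (Suc c) M = {\<one>})"
proof
  assume "virtually_nilpotent c G T"
  then obtain H where H: "subgroup H G" "openin T H" "lc (Suc c) H = {\<one>}"
    by (auto simp: virtually_nilpotent_def)
  obtain M where M: "open_normal M" "M \<subseteq> H" using normal_core[OF H(1,2)] .
  have "\<one> \<in> lc (Suc c) M"
    using closed_normalD(5) closed_normal_lc open_normal_imp_closed_normal M by blast
  then have "lc (Suc c) M = {\<one>}" using lc_mono[OF M(2), of "Suc c"] H by auto
  then show "\<exists>M. open_normal M \<and> lc (Suc c) M = {\<one>}" using M by blast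
qed (auto simp: virtually_nilpotent_def dest: open_normalD)

context
  fixes N assumes N: "closed_normal N"
begin

lemma coset_group_hom: "group_hom G (G Mod N) ((#>) N)"
  using normal.coset_hom closed_normalD(1)[OF N] .

lemma coset_saturation:
  assumes "F \<subseteq> carrier G"
  shows "{x \<in> carrier G. N #> x \<in> (#>) N ` F} = N <#> F"
proof (intro equalityI subsetI)
  fix x assume "x \<in> {x \<in> carrier G. N #> x \<in> (#>) N ` F}"
  then obtain f where f: "x \<in> carrier G" "f \<in> F" "N #> x = N #> f" by auto
  then have "x \<in> N #> f" using rcos_self[of x N] closed_normalD(3)[OF N] by auto
  then show "x \<in> N <#> F" using f by (auto simp: r_coset_def mem_set_mult)
next
  fix x assume "x \<in> N <#> F"
  then obtain n f where nf: "n \<in> N" "f \<in> F" "x = n \<otimes> f" by (auto simp: mem_set_mult)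
  have nc: "n \<in> carrier G" "f \<in> carrier G" using nf closed_normalD(4)[OF N] assms by auto
  have "N #> x = (N #> n) #> f"
    using nf nc closed_normalD(4)[OF N] by (simp add: coset_mult_assoc)
  also have "N #> n = N" using nf nc closed_normalD(3)[OF N] by (simp add: coset_join2)
  finally have "N #> x = N #> f" .
  then show "x \<in> {x \<in> carrier G. N #> x \<in> (#>) N ` F}"
    using nf nc by auto
qed

text \<open>The saturation of \<open>F\<close> is the product \<open>N <#> F\<close> of two closed
  sets, so the projection is a closed map.\<close>

lemma closedin_quotient_image:
  assumes "closedin T F"
  shows "closedin (quotient_topology G T N) ((#>) N ` F)"
proof -
  have F: "F \<subseteq> carrier G" using assms by (rule closed_subset_carrier)
  have q: "quotient_map T (quotient_topology G T N) ((#>) N)" by (rule quotient_map_cosets[OF topspace_eq])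
  have sub: "(#>) N ` F \<subseteq> topspace (quotient_topology G T N)"
    using F q by (auto simp: quotient_map_def topspace_eq)
  have "closedin T {x \<in> carrier G. N #> x \<in> (#>) N ` F}"
    unfolding coset_saturation[OF F] using N assms by (simp add: closedin_set_mult closed_normalD)
  then show ?thesis
    using q sub by (simp add: quotient_map_closedin topspace_eq)
qed

lemma subgroup_coset_preimage:
  assumes "subgroup H (G Mod N)"
  shows "subgroup {x \<in> carrier G. N #> x \<in> H} G"
proof -
  interpret h: group_hom G "G Mod N" "(#>) N" by (rule coset_group_hom)
  interpret H: subgroup H "G Mod N" by fact
  show ?thesis
  proof (rule subgroup.intro)
    show "\<one> \<in> {x \<in> carrier G. N #> x \<in> H}" using H.one_closed h.hom_one by simp
    fix x y assume x: "x \<in> {x \<in> carrier G. N #> x \<in> H}"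
    then show "inv x \<in> {x \<in> carrier G. N #> x \<in> H}" using H.m_inv_closed[of "N #> x"] by simp
    assume "y \<in> {x \<in> carrier G. N #> x \<in> H}"
    then show "x \<otimes> y \<in> {x \<in> carrier G. N #> x \<in> H}"
      using x H.m_closed[of "N #> x" "N #> y"] h.hom_mult by simp
  qed auto
qed

text \<open>One inclusion holds because the projection is closed, the other because preimages of
  closed subgroups are closed subgroups.\<close>

lemma csg_quotient:
  assumes S: "S \<subseteq> carrier G"
  shows "closed_subgroup_generated (G Mod N) (quotient_topology G T N) ((#>) N ` S) =
    (#>) N ` closed_subgroup_generated G T S"
proof
  interpret group_hom G "G Mod N" "(#>) N" by (rule coset_group_hom)
  show "closed_subgroup_generated (G Mod N) (quotient_topology G T N) ((#>) N ` S) \<subseteq>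
      (#>) N ` closed_subgroup_generated G T S"
    unfolding closed_subgroup_generated_def[of "G Mod N"]
    using csg_closed_subgroup[OF S] csg_superset[of S]
    by (intro hull_minimal) (auto intro: subgroup_img_is_subgroup closedin_quotient_image)
  have "closed_subgroup_generated G T S \<subseteq> {x \<in> carrier G. N #> x \<in> H}"
    if H: "subgroup H (G Mod N)" "closedin (quotient_topology G T N) H" "(#>) N ` S \<subseteq> H" for H
  proof (rule csg_minimal)
    have "continuous_map T (quotient_topology G T N) ((#>) N)"
      by (simp add: quotient_imp_continuous_map quotient_map_cosets topspace_eq)
    from closedin_continuous_map_preimage[OF this H(2)]
    show "closedin T {x \<in> carrier G. N #> x \<in> H}" by (simp add: topspace_eq)
  qed (use S H subgroup_coset_preimage in auto)
  then show "(#>) N ` closed_subgroup_generated G T S \<subseteq>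
      closed_subgroup_generated (G Mod N) (quotient_topology G T N) ((#>) N ` S)"
    unfolding closed_subgroup_generated_def[of "G Mod N"] hull_def by blast
qed

lemma lower_central_quotient:
  assumes K: "K \<subseteq> carrier G"
  shows "lower_central (G Mod N) (quotient_topology G T N) i ((#>) N ` K) = (#>) N ` lc i K"
    and "lc i K \<subseteq> carrier G"
proof -
  have "lc i K \<subseteq> carrier G \<and>
      lower_central (G Mod N) (quotient_topology G T N) i ((#>) N ` K) = (#>) N ` lc i K"
  proof (induction i rule: induct_nat_012)
    case (ge2 i)
    let ?L = "lc (Suc i) K"
    have L: "?L \<subseteq> carrier G" using ge2 by auto
    have "{commutator (G Mod N) x y | x y. x \<in> (#>) N ` ?L \<and> y \<in> (#>) N ` K} =
        (#>) N ` {commutator G x y | x y. x \<in> ?L \<and> y \<in> K}"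
    proof -
      have "N #> commutator G x y = commutator (G Mod N) (N #> x) (N #> y)" if "x \<in> ?L" "y \<in> K" for x y
        using that L K normal.coset_commutator[OF closed_normalD(1)[OF N]] by blast
      then show ?thesis by (auto simp: image_iff) metis+
    qed
    then show ?case
      using ge2 commutator_subgroup_closed(1)[OF L K, THEN subgroup.subset]
        csg_quotient[OF commutators_subset_carrier[OF L K]]
      by (simp add: commutator_subgroup_def)
  qed (use K in auto)
  then show "lower_central (G Mod N) (quotient_topology G T N) i ((#>) N ` K) = (#>) N ` lc i K"
    and "lc i K \<subseteq> carrier G" by auto
qed

text \<open>This eliminates the quotient topology: from here on, virtual nilpotency of
  \<open>G Mod N\<close> is an inclusion between subgroups of \<open>G\<close>.\<close>

lemma virtually_nilpotent_quotient_iff: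
  "virtually_nilpotent c (G Mod N) (quotient_topology G T N) \<longleftrightarrow>
     (\<exists>M. open_normal M \<and> lc (Suc c) M \<subseteq> N)"
proof -
  interpret group_hom G "G Mod N" "(#>) N" by (rule coset_group_hom)
  let ?T = "quotient_topology G T N"
  have trivial_iff: "(#>) N ` L = {\<one>\<^bsub>G Mod N\<^esub>} \<longleftrightarrow> L \<subseteq> N" if "L \<subseteq> carrier G" "L \<noteq> {}" for L
    using that normal.coset_eq_one_iff[OF closed_normalD(1)[OF N]] by (auto simp: image_iff)
  show ?thesis
  proof
    assume "virtually_nilpotent c (G Mod N) ?T"
    then obtain H where H: "subgroup H (G Mod N)" "openin ?T H"
        "lower_central (G Mod N) ?T (Suc c) H = {\<one>\<^bsub>G Mod N\<^esub>}"
      by (auto simp: virtually_nilpotent_def)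
    define L where "L = {x \<in> carrier G. N #> x \<in> H}"
    have "openin T L" using H(2) by (simp add: L_def openin_quotient_topology topspace_eq)
    moreover have sL: "subgroup L G" unfolding L_def by (rule subgroup_coset_preimage[OF H(1)])
    ultimately obtain M where M: "open_normal M" "M \<subseteq> L" by (meson normal_core)
    have "H \<subseteq> carrier (G Mod N)" using H(1) by (rule subgroup.subset)
    then have "(#>) N ` L = H" by (auto simp: L_def carrier_FactGroup)
    then have img: "(#>) N ` lc (Suc c) L = {\<one>\<^bsub>G Mod N\<^esub>}"
      using H(3) lower_central_quotient(1)[OF subgroup.subset[OF sL], of "Suc c"] by simp
    then have "lc (Suc c) L \<subseteq> N"
      using trivial_iff[OF lower_central_quotient(2)[OF subgroup.subset[OF sL]], of "Suc c"] by auto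
    then show "\<exists>M. open_normal M \<and> lc (Suc c) M \<subseteq> N" using M lc_mono[of M L "Suc c"] by blast
  next
    assume "\<exists>M. open_normal M \<and> lc (Suc c) M \<subseteq> N"
    then obtain M where M: "open_normal M" "lc (Suc c) M \<subseteq> N" by blast
    have Mc: "M \<subseteq> carrier G" using open_normalD(5)[OF M(1)] .
    have "{x \<in> topspace T. N #> x \<in> (#>) N ` M} = N <#> M"
      using coset_saturation[OF Mc] by (simp add: topspace_eq)
    then have "openin ?T ((#>) N ` M)"
      using open_normalD(2)[OF open_normal_set_mult[OF closed_normalD(1)[OF N] M(1)]] Mc
      by (auto simp: openin_quotient_topology carrier_FactGroup)
    moreover have "subgroup ((#>) N ` M) (G Mod N)"
      using open_normalD(4)[OF M(1)] by (rule subgroup_img_is_subgroup)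
    moreover have "lower_central (G Mod N) ?T (Suc c) ((#>) N ` M) = {\<one>\<^bsub>G Mod N\<^esub>}"
      unfolding lower_central_quotient(1)[OF Mc]
      using trivial_iff[OF lower_central_quotient(2)[OF Mc, of "Suc c"]] M(2)
        closed_normalD(5)[OF closed_normal_lc[OF open_normal_imp_closed_normal[OF M(1)], of "Suc c"]]
      by auto
    ultimately show "virtually_nilpotent c (G Mod N) ?T"
      unfolding virtually_nilpotent_def by auto
  qed
qed

end

lemma JNNF_iff:
  "JNNF c G T \<longleftrightarrow> \<not> virtually_nilpotent c G T \<and>
     (\<forall>N. closed_normal N \<and> N \<noteq> {\<one>} \<longrightarrow> (\<exists>M. open_normal M \<and> lc (Suc c) M \<subseteq> N))"
  unfolding JNNF_def using virtually_nilpotent_quotient_iff by (auto simp: closed_normal_def)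

end

section \<open>Finitely generated profinite groups\<close>

context group
begin

lemma countable_generate:
  assumes "countable S" "S \<subseteq> carrier G"
  shows "countable (generate G S)"
proof -
  let ?S = "S \<union> (\<lambda>x. inv x) ` S" and ?f = "\<lambda>xs. foldr (\<otimes>) xs \<one>"
  have S: "?S \<subseteq> carrier G" using assms by auto
  have fc: "?f xs \<in> carrier G" if "set xs \<subseteq> carrier G" for xs
    using that by (induction xs) auto
  have app: "?f (xs @ ys) = ?f xs \<otimes> ?f ys" if "set xs \<subseteq> carrier G" "set ys \<subseteq> carrier G" for xs ys
    using that fc by (induction xs) (auto simp: m_assoc)
  have "x \<in> ?f ` lists ?S" if "x \<in> generate G S" for x
    using that
  proof (induction rule: generate.induct)
    case one
    then show ?case by (intro image_eqI[of _ _ "[]"]) auto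
  next
    case (incl h)
    then show ?case using S by (intro image_eqI[of _ _ "[h]"]) auto
  next
    case (inv h)
    then show ?case using S by (intro image_eqI[of _ _ "[inv h]"]) auto
  next
    case (eng h1 h2)
    then obtain xs ys where *: "xs \<in> lists ?S" "h1 = ?f xs" "ys \<in> lists ?S" "h2 = ?f ys" by auto
    moreover have "set xs \<subseteq> carrier G" "set ys \<subseteq> carrier G" using * S by auto
    ultimately show ?case
      by (intro image_eqI[of _ _ "xs @ ys"]) (auto simp only: app append_in_lists_conv)
  qed
  then have "generate G S \<subseteq> ?f ` lists ?S" by blast
  then show ?thesis
    using assms(1) by (meson countable_Un countable_image countable_lists countable_subset)
qed

end

context profinite_group
begin

text \<open>The product is a subgroup containing the open \<open>H\<close>, hence open, hence
  closed; it contains the topological generators.\<close>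

lemma open_normal_generate_dense:
  assumes S: "S \<subseteq> carrier G" "closed_subgroup_generated G T S = carrier G" and H: "open_normal H"
  shows "H <#> generate G S = carrier G"
proof -
  have gen: "subgroup (generate G S) G" using S by (intro generate_is_subgroup)
  interpret second_isomorphism_grp H G "generate G S"
    using open_normalD(1)[OF H] gen
    by (simp add: second_isomorphism_grp_def second_isomorphism_grp_axioms_def)
  let ?P = "H <#> generate G S"
  have P: "subgroup ?P G" by (rule normal_set_mult_subgroup)
  have up: "H \<subseteq> ?P" "generate G S \<subseteq> ?P" using set_mult_upper[OF open_normalD(4)[OF H] gen] .
  have "closedin T ?P"
    using openin_subgroup[OF P open_normalD(2)[OF H] open_normalD(6)[OF H] up(1)]
    by (rule closedin_open_subgroup[OF P])
  moreover have "S \<subseteq> ?P" by (auto intro: generate.incl subsetD[OF up(2)])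
  ultimately show ?thesis using csg_minimal[OF _ P] S subgroup.subset[OF P] by blast
qed

text \<open>Schreier's argument: the generators come from a transversal \<open>R\<close> chosen inside the abstract
  subgroup generated by \<open>S\<close>.\<close>

lemma open_normal_finitely_generated:
  assumes S: "finite S" "S \<subseteq> carrier G" "closed_subgroup_generated G T S = carrier G"
    and H: "open_normal H"
  obtains F where "finite F" "F \<subseteq> generate G S" "closed_subgroup_generated G T F = H"
proof -
  let ?\<Gamma> = "generate G S"
  note HD = open_normalD[OF H]
  interpret H: normal H G using HD(1) .
  have gen: "subgroup ?\<Gamma> G" using S by (intro generate_is_subgroup)
  have \<Gamma>c: "?\<Gamma> \<subseteq> carrier G" using gen subgroup.subset by blast
  \<comment> \<open>Representing the trivial coset by \<open>\<one>\<close> ensures that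
    \<open>R\<close> meets \<open>H\<close> only in \<open>\<one>\<close>, which the final inclusion
    \<open>H \<subseteq> ?L\<close> relies on.\<close>
  define rep where "rep C = (if C = H then \<one> else SOME t. t \<in> C \<inter> ?\<Gamma>)" for C
  define r where "r x = rep (H #> x)" for x
  have r: "r x \<in> ?\<Gamma>" "H #> r x = H #> x" if x: "x \<in> carrier G" for x
  proof -
    have "r x \<in> (H #> x) \<inter> ?\<Gamma>"
    proof (cases "H #> x = H")
      case True
      then show ?thesis using subgroup.one_closed[OF gen] HD(6) by (simp add: r_def rep_def)
    next
      case False
      have "x \<in> H <#> ?\<Gamma>" using open_normal_generate_dense[OF S(2,3) H] x by simp
      then obtain h t where ht: "h \<in> H" "t \<in> ?\<Gamma>" "x = h \<otimes> t" by (auto simp: mem_set_mult)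
      then have "t = inv h \<otimes> x" using \<Gamma>c by (simp add: subset_iff)
      then have "t \<in> H #> x" using ht by (auto simp: r_coset_def)
      then have "\<exists>t. t \<in> (H #> x) \<inter> ?\<Gamma>" using ht by blast
      then show ?thesis using False unfolding r_def rep_def by (simp only: if_False) (rule someI_ex)
    qed
    then show "r x \<in> ?\<Gamma>" "H #> r x = H #> x"
      using x repr_independence[of "r x" H x] HD(4) by auto
  qed
  define R where "R = r ` carrier G"
  have R\<Gamma>: "R \<subseteq> ?\<Gamma>" using r by (auto simp: R_def)
  have "R = rep ` (rcosets H)" by (auto simp: R_def r_def RCOSETS_def)
  then have finR: "finite R" using finite_rcosets_open[OF HD(4,2)] by simp
  have r_one: "r x = \<one>" if "x \<in> H" for x
    using that coset_join2[of x H] HD(4) by (simp add: r_def rep_def)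
  let ?S = "S \<union> (\<lambda>x. inv x) ` S"
  have Sgen: "?S \<subseteq> ?\<Gamma>" by (auto intro: generate.incl generate.inv)
  \<comment> \<open>The Schreier generators, finite in number because \<open>R\<close> and
    \<open>S\<close> are finite.\<close>
  define F where "F = (\<lambda>(t, s). t \<otimes> s \<otimes> inv (r (t \<otimes> s))) ` (R \<times> ?S)"
  have ts: "t \<otimes> s \<in> ?\<Gamma>" "t \<otimes> s \<in> carrier G" if "t \<in> R" "s \<in> ?S" for t s
    using that R\<Gamma> Sgen subgroup.m_closed[OF gen] \<Gamma>c by blast+
  have F\<Gamma>: "F \<subseteq> ?\<Gamma>"
    unfolding F_def using ts r subgroup.m_closed[OF gen] subgroup.m_inv_closed[OF gen] by auto
  have FH: "F \<subseteq> H"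
  proof
    fix x assume "x \<in> F"
    then obtain t s where x: "t \<in> R" "s \<in> ?S" "x = t \<otimes> s \<otimes> inv (r (t \<otimes> s))" by (auto simp: F_def)
    have "t \<otimes> s \<in> H #> r (t \<otimes> s)" using r ts[OF x(1,2)] rcos_self HD(4) by simp
    then show "x \<in> H"
      using x r \<Gamma>c ts[OF x(1,2)] H.rcos_module[OF is_group, of "r (t \<otimes> s)" "t \<otimes> s"] by blast
  qed
  let ?L = "closed_subgroup_generated G T F"
  have Fc: "F \<subseteq> carrier G" using F\<Gamma> \<Gamma>c by blast
  note L = csg_closed_subgroup[OF Fc]
  have LH: "?L \<subseteq> H" using csg_minimal[OF FH HD(4,3)] .
  have Lc: "?L \<subseteq> carrier G" using L(1) by (rule subgroup.subset)
  have Rc: "R \<subseteq> carrier G" using R\<Gamma> \<Gamma>c by blast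
  have "?L <#> R = (\<Union>t\<in>R. ?L #> t)" by (auto simp: set_mult_def r_coset_def)
  moreover have "closedin T (\<Union>t\<in>R. ?L #> t)"
    using finR Rc L(2) by (intro closedin_Union) (auto intro: closedin_r_coset)
  ultimately have P_closed: "closedin T (?L <#> R)" by simp
  have one_P: "\<one> \<in> ?L <#> R"
  proof -
    have "\<one> \<in> R" using r_one[OF HD(6)] unfolding R_def by (metis imageI one_closed)
    then show ?thesis using subgroup.one_closed[OF L(1)] unfolding mem_set_mult by force
  qed
  \<comment> \<open>Right multiplication by members of \<open>A\<close> preserves the closed set
    \<open>?L <#> R\<close>. The subgroup \<open>B\<close> is closed and contains \<open>S\<close>,
    so it is everything; applied to \<open>\<one>\<close> this gives
    \<open>?L <#> R = carrier G\<close>.\<close>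
  define A where "A = {y \<in> carrier G. \<forall>x\<in>?L <#> R. x \<otimes> y \<in> ?L <#> R}"
  define B where "B = A \<inter> {y \<in> carrier G. inv y \<in> A}"
  have Pc: "?L <#> R \<subseteq> carrier G" using setmult_subset_G[OF Lc Rc] .
  have "closedin T A"
  proof -
    have "closedin T (\<Inter>x\<in>?L <#> R. {y \<in> carrier G. x \<otimes> y \<in> ?L <#> R})"
      using one_P Pc
      by (intro closedin_INT closedin_preimage continuous_map_group P_closed) auto
    moreover have "(\<Inter>x\<in>?L <#> R. {y \<in> carrier G. x \<otimes> y \<in> ?L <#> R}) = A"
      using one_P by (auto simp: A_def)
    ultimately show ?thesis by simp
  qed
  then have B_closed: "closedin T B"
    unfolding B_def by (intro closedin_Int closedin_preimage continuous_map_group)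
  have B_sub: "subgroup B G"
  proof (rule subgroup.intro)
    show "\<one> \<in> B" using Pc by (auto simp: B_def A_def)
    show "x \<otimes> y \<in> B" if "x \<in> B" "y \<in> B" for x y
      using that Pc by (auto simp: B_def A_def inv_mult_group subset_iff simp flip: m_assoc)
  qed (auto simp: B_def A_def)
  have SA: "s \<in> A" if s: "s \<in> ?S" for s
  proof -
    have sc: "s \<in> carrier G" using s S by auto
    have "x \<otimes> s \<in> ?L <#> R" if xP: "x \<in> ?L <#> R" for x
    proof -
      obtain l t where x: "l \<in> ?L" "t \<in> R" "x = l \<otimes> t" using xP by (auto simp: mem_set_mult)
      have f: "t \<otimes> s \<otimes> inv (r (t \<otimes> s)) \<in> ?L"
        using x s csg_superset[of F] by (auto simp: F_def)
      have rR: "r (t \<otimes> s) \<in> R" "r (t \<otimes> s) \<in> carrier G" using ts[OF x(2) s] Rc by (auto simp: R_def)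
      have "x \<otimes> s = (l \<otimes> (t \<otimes> s \<otimes> inv (r (t \<otimes> s)))) \<otimes> r (t \<otimes> s)"
        using x sc rR Lc Rc by (simp add: m_assoc subset_iff)
      then show ?thesis using subgroup.m_closed[OF L(1) x(1) f] rR unfolding mem_set_mult by blast
    qed
    then show ?thesis using sc by (simp add: A_def)
  qed
  have "S \<subseteq> B" using SA S by (auto simp: B_def)
  from csg_minimal[OF this B_sub B_closed] have "carrier G \<subseteq> B" using S(3) by simp
  have P: "y \<in> ?L <#> R" if y: "y \<in> carrier G" for y
  proof -
    have "y \<in> A" using y \<open>carrier G \<subseteq> B\<close> by (auto simp: B_def)
    then have "\<one> \<otimes> y \<in> ?L <#> R" using one_P unfolding A_def by blast
    then show ?thesis using y by simp
  qed
  have "H \<subseteq> ?L"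
  proof
    fix h assume h: "h \<in> H"
    then obtain l t where lt: "l \<in> ?L" "t \<in> R" "h = l \<otimes> t" using P[of h] by (auto simp: mem_set_mult)
    then have "t = inv l \<otimes> h" using Lc Rc by (simp add: subset_iff)
    moreover have "inv l \<otimes> h \<in> H"
      using lt(1) LH h HD(4) by (intro subgroup.m_closed subgroup.m_inv_closed) auto
    ultimately have tH: "t \<in> H" by simp
    obtain x where x: "x \<in> carrier G" "t = r x" using lt by (auto simp: R_def)
    then have "H #> x = H" using r(2)[of x] tH coset_join2[of t H] HD(4) by auto
    then have "t = \<one>" using x by (simp add: r_def rep_def)
    then show "h \<in> ?L" using lt Lc by auto
  qed
  then show thesis using that[of F] LH F\<Gamma> finR S(1) by (simp add: F_def)
qed

text \<open>Each open normal subgroup is topologically generated by a finite subset of the fixed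
  countable group \<open>generate G S\<close>, and that group has only countably many finite
  subsets.\<close>

lemma countable_open_normal:
  assumes "topologically_fg G T"
  shows "countable {H. open_normal H}"
proof -
  obtain S where S: "finite S" "S \<subseteq> carrier G" "closed_subgroup_generated G T S = carrier G"
    using assms by (auto simp: topologically_fg_def)
  have "{H. open_normal H} \<subseteq> closed_subgroup_generated G T ` {F. finite F \<and> F \<subseteq> generate G S}"
  proof
    fix H assume "H \<in> {H. open_normal H}"
    then obtain F where "finite F" "F \<subseteq> generate G S" "closed_subgroup_generated G T F = H"
      using open_normal_finitely_generated[OF S] by blast
    then show "H \<in> closed_subgroup_generated G T ` {F. finite F \<and> F \<subseteq> generate G S}" by auto
  qed
  moreover have "countable (generate G S)" using S by (intro countable_generate countable_finite)
  ultimately show ?thesis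
    by (rule countable_subset[OF _ countable_image[OF countable_Collect_finite_subset]])
qed

lemma countable_open_normal_base:
  assumes "topologically_fg G T"
  obtains U :: "nat \<Rightarrow> 'a set" where "\<And>i. open_normal (U i)" "decseq U"
    "\<And>V. open_normal V \<Longrightarrow> \<exists>i. U i \<subseteq> V"
proof -
  define f where "f = from_nat_into {H. open_normal H}"
  have ne: "{H. open_normal H} \<noteq> {}" using open_normal_carrier by blast
  have f: "open_normal (f i)" for i using from_nat_into[OF ne, of i] by (simp add: f_def)
  show thesis
  proof (rule that)
    show "open_normal (\<Inter>j\<le>i. f j)" for i
      by (induction i) (auto simp: f atMost_Suc intro: open_normal_Int)
    show "decseq (\<lambda>i. \<Inter>j\<le>i. f j)" by (fastforce simp: decseq_def)
    show "\<exists>i. (\<Inter>j\<le>i. f j) \<subseteq> V" if V: "open_normal V" for V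
    proof -
      obtain i where "f i = V"
        using from_nat_into_surj[OF countable_open_normal[OF assms], of V] V by (auto simp: f_def)
      then show ?thesis by (intro exI[of _ i]) auto
    qed
  qed
qed

text \<open>\<open>Z / K\<close> is abelian, topologically finitely generated and of exponent
  dividing \<open>e\<close>, hence finite. The proof builds finitely many covering cosets by
  adjoining the generators in \<open>F\<close> one at a time.\<close>

lemma openin_bounded_exponent_abelian:
  assumes Z: "open_normal Z" "closed_subgroup_generated G T F = Z" "finite F"
    and K: "closed_normal K" "K \<subseteq> Z"
    and ab: "\<And>x y. \<lbrakk>x \<in> Z; y \<in> Z\<rbrakk> \<Longrightarrow> commutator G x y \<in> K"
    and ex: "0 < (e::nat)" "\<And>x. x \<in> Z \<Longrightarrow> x [^] e \<in> K"
  shows "open_normal K"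
proof -
  note ZD = open_normalD[OF Z(1)] and KD = closed_normalD[OF K(1)]
  have FZ: "F \<subseteq> Z" using Z(2) csg_superset by blast
  have powZ: "x [^] (n::nat) \<in> Z" if "x \<in> Z" for x n
    using that ZD(4) by (induction n) (auto intro: subgroup.m_closed simp: ZD(6))
  have "\<exists>R. finite R \<and> R \<subseteq> Z \<and> subgroup (K <#> R) G \<and> F \<subseteq> K <#> R \<and> K \<subseteq> K <#> R"
    using Z(3) FZ
  proof (induction F rule: finite_induct)
    case empty
    have "K <#> {\<one>} = K" using KD(4) by (auto simp: set_mult_def subset_iff)
    then show ?case using KD ZD(6) by (intro exI[of _ "{\<one>}"]) auto
  next
    case (insert f F)
    then obtain R where R: "finite R" "R \<subseteq> Z" "subgroup (K <#> R) G" "F \<subseteq> K <#> R" "K \<subseteq> K <#> R"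
      by auto
    let ?L = "K <#> R"
    have fZ: "f \<in> Z" using insert.prems by simp
    have LZ: "?L \<subseteq> Z" using set_mult_least[OF ZD(4) K(2) R(2)] .
    define R' where "R' = (\<lambda>(a, t). f [^] a \<otimes> t) ` ({..<e} \<times> R)"
    have R'Z: "R' \<subseteq> Z" using powZ[OF fZ] R(2) subgroup.m_closed[OF ZD(4)] by (auto simp: R'_def)
    \<comment> \<open>The exponent may be any natural number: the power of \<open>f [^] e\<close>
      lies in \<open>K\<close> and is absorbed by \<open>?L\<close>, leaving an exponent below
      \<open>e\<close>.\<close>
    have mem: "f [^] a \<otimes> l \<in> K <#> R'" if l: "l \<in> ?L" for a :: nat and l
    proof -
      have "f [^] (e * (a div e)) = (f [^] e) [^] (a div e)"
        using fZ ZD(5) by (simp add: nat_pow_pow subset_iff)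
      moreover have "x [^] (n::nat) \<in> K" if "x \<in> K" for x n
        using that KD by (induction n) (auto intro: subgroup.m_closed)
      ultimately have q: "f [^] (e * (a div e)) \<in> K" using ex(2)[OF fZ] by simp
      have "f [^] a = f [^] (a mod e) \<otimes> f [^] (e * (a div e))"
        using fZ ZD(5) by (subst nat_pow_mult) (auto simp: subset_iff)
      moreover have "f [^] (e * (a div e)) \<otimes> l \<in> ?L"
        using q l R(3,5) by (auto intro: subgroup.m_closed)
      then obtain k t where kt: "k \<in> K" "t \<in> R" "f [^] (e * (a div e)) \<otimes> l = k \<otimes> t"
        by (auto simp: mem_set_mult)
      moreover have c: "f \<in> carrier G" "l \<in> carrier G" "k \<in> carrier G" "t \<in> carrier G"
        using fZ l LZ ZD(5) kt KD R(2) by auto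
      ultimately have "f [^] a \<otimes> l = (f [^] (a mod e) \<otimes> k \<otimes> inv (f [^] (a mod e))) \<otimes> (f [^] (a mod e) \<otimes> t)"
        by (simp add: m_assoc)
      moreover have "f [^] (a mod e) \<otimes> k \<otimes> inv (f [^] (a mod e)) \<in> K"
        using normal.inv_op_closed2[OF KD(1)] kt c by simp
      moreover have "f [^] (a mod e) \<otimes> t \<in> R'" using kt ex(1) by (auto simp: R'_def)
      ultimately show ?thesis unfolding mem_set_mult by blast
    qed
    have form: "\<exists>a l. x = f [^] (a::nat) \<otimes> l \<and> l \<in> ?L" if xR: "x \<in> K <#> R'" for x
    proof -
      obtain k a t where x: "k \<in> K" "t \<in> R" "x = k \<otimes> (f [^] (a::nat) \<otimes> t)"
        using xR by (auto simp: mem_set_mult R'_def)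
      have c: "k \<in> carrier G" "f \<in> carrier G" "t \<in> carrier G" using x KD R(2) ZD(5) fZ by auto
      have "inv (f [^] a) \<otimes> k \<otimes> f [^] a \<in> K" using normal.inv_op_closed1[OF KD(1)] x c by simp
      then have "(inv (f [^] a) \<otimes> k \<otimes> f [^] a) \<otimes> t \<in> ?L" using x unfolding mem_set_mult by blast
      moreover have "x = f [^] a \<otimes> ((inv (f [^] a) \<otimes> k \<otimes> f [^] a) \<otimes> t)"
        using x c by (simp add: m_assoc)
      ultimately show ?thesis by blast
    qed
    have L'Z: "K <#> R' \<subseteq> Z" using set_mult_least[OF ZD(4) K(2) R'Z] .
    have sub: "K \<subseteq> K <#> R'" using mem[of _ 0] R(5) KD(4) by (force simp: subset_iff)
    have mult: "x \<otimes> y \<in> K <#> R'" if xy: "x \<in> K <#> R'" "y \<in> K <#> R'" for x y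
    proof -
      obtain a l b l' where x: "x = f [^] (a::nat) \<otimes> l" "l \<in> ?L" and y: "y = f [^] (b::nat) \<otimes> l'" "l' \<in> ?L"
        using form xy by metis
      have c: "f \<in> carrier G" "l \<in> carrier G" "l' \<in> carrier G" using fZ x y LZ ZD(5) by auto
      have "commutator G l (f [^] b) \<in> ?L" using ab[of l "f [^] b"] x LZ powZ[OF fZ] R(5) by auto
      then have "l \<otimes> commutator G l (f [^] b) \<otimes> l' \<in> ?L" using x y R(3) by (simp add: subgroup.m_closed)
      from mem[OF this, of "a + b"] show ?thesis
        using c by (simp add: x(1) y(1) commutator_def m_assoc flip: nat_pow_mult)
    qed
    have "subgroup (K <#> R') G"
    proof (rule subgroup.intro)
      show "K <#> R' \<subseteq> carrier G" using L'Z ZD(5) by blast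
      show one: "\<one> \<in> K <#> R'" using sub KD(5) by blast
      fix x assume x: "x \<in> K <#> R'"
      then have xZ: "x \<in> Z" "x \<in> carrier G" using L'Z ZD(5) by auto
      \<comment> \<open>Closure under products already gives inverses, because
        \<open>x [^] e\<close> lies in \<open>K\<close>.\<close>
      have "x [^] n \<in> K <#> R'" for n :: nat
        by (induction n) (use one x in \<open>auto intro: mult\<close>)
      moreover have "inv (x [^] e) \<in> K <#> R'"
        using ex(2)[OF xZ(1)] sub KD(3) by (blast intro: subgroup.m_inv_closed)
      ultimately have "x [^] (e - 1) \<otimes> inv (x [^] e) \<in> K <#> R'" by (rule mult)
      moreover have "x [^] e = x \<otimes> x [^] (e - 1)"
        using ex(1) xZ(2) by (metis Suc_pred' nat_pow_Suc2)
      then have "x [^] (e - 1) \<otimes> inv (x [^] e) = inv x" using xZ(2) by (simp add: inv_mult_group)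
      ultimately show "inv x \<in> K <#> R'" by simp
    qed (rule mult)
    moreover have "finite R'" using R(1) by (simp add: R'_def)
    moreover have "f \<in> K <#> R'"
      using mem[of \<one> 1] R(3) fZ ZD(5) by (simp add: subgroup.one_closed subset_iff)
    moreover have "F \<subseteq> K <#> R'"
    proof
      fix x assume "x \<in> F"
      then show "x \<in> K <#> R'" using mem[of x 0] R(4) LZ ZD(5) by (simp add: subset_iff)
    qed
    ultimately show ?case using R'Z sub by blast
  qed
  then obtain R where R: "finite R" "R \<subseteq> Z" "subgroup (K <#> R) G" "F \<subseteq> K <#> R" by blast
  have cos: "K <#> R' = (\<Union>t\<in>R'. K #> t)" for R' by (auto simp: set_mult_def r_coset_def)
  have cl: "closedin T (K <#> R')" if "R' \<subseteq> R" for R'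
    unfolding cos using that R(2) ZD(5) KD(2) finite_subset[OF that R(1)]
    by (intro closedin_Union) (auto intro!: closedin_r_coset)
  have "Z \<subseteq> K <#> R" using csg_minimal[OF R(4) R(3) cl] Z(2) by simp
  \<comment> \<open>Removing from \<open>Z\<close> the finitely many closed cosets other than
    \<open>K\<close> shows that \<open>K\<close> is open.\<close>
  have "K = Z - (K <#> (R - K))"
  proof (intro equalityI subsetI)
    fix x assume x: "x \<in> K"
    have "x \<notin> K <#> (R - K)"
    proof
      assume "x \<in> K <#> (R - K)"
      then obtain k t where kt: "k \<in> K" "t \<in> R - K" "x = k \<otimes> t" by (auto simp: mem_set_mult)
      then have "t = inv k \<otimes> x" using KD(4) R(2) ZD(5) by (simp add: subset_iff)
      moreover have "inv k \<otimes> x \<in> K"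
        using kt(1) x KD(3) by (intro subgroup.m_closed subgroup.m_inv_closed)
      ultimately have "t \<in> K" by simp
      then show False using kt by simp
    qed
    then show "x \<in> Z - (K <#> (R - K))" using x K(2) by auto
  next
    fix x assume x: "x \<in> Z - (K <#> (R - K))"
    then have "x \<in> K <#> R" using \<open>Z \<subseteq> K <#> R\<close> by blast
    then obtain k t where kt: "k \<in> K" "t \<in> R" "x = k \<otimes> t" by (auto simp: mem_set_mult)
    have "t \<in> K"
    proof (rule ccontr)
      assume "t \<notin> K"
      then have "x \<in> K <#> (R - K)" using kt by (auto simp: mem_set_mult)
      then show False using x by simp
    qed
    then show "x \<in> K" using kt KD(3) by (simp add: subgroup.m_closed)
  qed
  moreover have "openin T (Z - (K <#> (R - K)))"
    using ZD(2) cl[of "R - K"] by (intro openin_diff) auto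
  ultimately show ?thesis using KD(1) by (simp add: open_normal_def)
qed

end

section \<open>Perturbing normal subgroups modulo a virtually nilpotent quotient\<close>

context profinite_group
begin

lemma open_normal_pow_mem:
  assumes "open_normal M"
  obtains e :: nat where "0 < e" "\<And>x. x \<in> carrier G \<Longrightarrow> x [^] e \<in> M"
proof
  note MD = open_normalD[OF assms]
  interpret normal M G using MD(1) .
  interpret Q: group "G Mod M" by (rule factorgroup_is_group)
  have "finite (carrier (G Mod M))"
    using finite_rcosets_open[OF MD(4,2)] by (simp add: FactGroup_def)
  then show "0 < order (G Mod M)" using Q.order_gt_0_iff_finite by simp
  fix x assume x: "x \<in> carrier G"
  have "M #> (x [^] order (G Mod M)) = \<one>\<^bsub>G Mod M\<^esub>"
    using Q.pow_order_eq_1[OF coset_closed[OF x]] coset_pow[OF x] by simp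
  then show "x [^] order (G Mod M) \<in> M"
    using coset_eq_one_iff x by simp
qed

text \<open>Modulo \<open>upper_central C W n\<close> the commutator map \<open>(x, w) \<mapsto> [x, w]\<close> below is bilinear, so
  exponents can be moved from \<open>x\<close> to \<open>w\<close>, where they push \<open>w\<close> into \<open>M\<close>.\<close>

lemma pow_mem_upper_central:
  fixes e :: nat
  assumes C: "closed_normal C" and W: "W \<lhd> G" and M: "closed_normal M" "M \<subseteq> W"
    and MC: "lc (Suc c) M \<subseteq> C" and e: "\<And>w. w \<in> W \<Longrightarrow> w [^] e \<in> M"
    and x: "x \<in> upper_central C W (Suc n)" "x \<in> lc t M" and t: "1 \<le> t" "Suc c \<le> t + n"
  shows "x [^] (e ^ n) \<in> upper_central C W n"
  using x t
proof (induction n arbitrary: x t)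
  case 0
  then have "x \<in> C" using lc_antimono[OF M(1), of "Suc c" t] MC by auto
  then show ?case using closed_normalD(4)[OF C] by auto
next
  case (Suc n)
  let ?U = "upper_central C W"
  have U: "closed_normal (?U i)" for i using C W by (rule closed_normal_upper_central)
  interpret normal "?U n" G using closed_normalD(1)[OF U] .
  interpret Q: group "G Mod ?U n" by (rule factorgroup_is_group)
  have xc: "x \<in> carrier G" using Suc.prems by simp
  have xW: "x \<in> W" using Suc.prems lc_subset[OF M(1)] M(2) by auto
  have "commutator G (x [^] (e ^ Suc n)) w \<in> ?U n" if w: "w \<in> W" for w
  proof -
    have wc: "w \<in> carrier G" using w W by (auto dest: normal_imp_subgroup subgroup.mem_carrier)
    \<comment> \<open>As \<open>w [^] e\<close> lies in \<open>M\<close>, \<open>?y\<close> is one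
      term further down the series of \<open>M\<close>: \<open>t\<close> rises while
      \<open>n\<close> drops, so the bound on \<open>t + n\<close> survives. Modulo
      \<open>?U n\<close>, \<open>?y\<close> is \<open>?d [^] e\<close>.\<close>
    let ?d = "commutator G x w" and ?y = "commutator G x (w [^] e)"
    have d: "?d \<in> ?U (Suc n)" using Suc.prems(1) w by simp
    then have *: "commutator G ?d x \<in> ?U n" "commutator G ?d w \<in> ?U n" using xW w by auto
    have we: "w [^] e \<in> W" using e[OF w] M(2) by auto
    have "?y \<in> ?U (Suc n)" using Suc.prems(1) we by simp
    moreover have "?y \<in> lc (Suc t) M" using lc_commutator Suc.prems e[OF w] by simp
    ultimately have y: "?y [^] (e ^ n) \<in> ?U n" using Suc.IH[of ?y "Suc t"] Suc.prems by simp
    have "?U n #> commutator G (x [^] (e ^ Suc n)) w = ?U n #> (?d [^] (e ^ Suc n))"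
      using commutator_pow_mod(1)[OF xc wc *] .
    also have "?d [^] (e ^ Suc n) = (?d [^] e) [^] (e ^ n)"
      using xc wc by (simp add: nat_pow_pow)
    also have "?U n #> \<dots> = (?U n #> ?y) [^]\<^bsub>G Mod ?U n\<^esub> (e ^ n)"
      using commutator_pow_mod(2)[OF xc wc *, of e] xc wc by (simp add: coset_pow)
    also have "\<dots> = ?U n #> (?y [^] (e ^ n))" using xc wc by (simp add: coset_pow)
    also have "\<dots> = \<one>\<^bsub>G Mod ?U n\<^esub>"
      using coset_eq_one_iff[of "?y [^] (e ^ n)"] y xc wc by simp
    finally show ?thesis using coset_eq_one_iff xc wc by simp
  qed
  then show ?case using xc by simp
qed

text \<open>Inside \<open>M\<close>, consecutive terms have an abelian quotient, and
  \<open>pow_mem_upper_central\<close> bounds its exponent by \<open>e ^ n\<close>. Starting there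
  from \<open>t = 1\<close> is what requires \<open>c \<le> n\<close>.\<close>

lemma open_normal_upper_central_step:
  assumes fg: "topologically_fg G T"
    and C: "closed_normal C" and W: "W \<lhd> G" and M: "open_normal M" "M \<subseteq> W"
    and MC: "lc (Suc c) M \<subseteq> C" and n: "c \<le> n" and U: "open_normal (upper_central C W (Suc n))"
  shows "open_normal (upper_central C W n)"
proof -
  let ?U = "upper_central C W"
  have Ucn: "closed_normal (?U i)" for i using C W by (rule closed_normal_upper_central)
  obtain e :: nat where e: "0 < e" "\<And>x. x \<in> carrier G \<Longrightarrow> x [^] e \<in> M"
    using open_normal_pow_mem[OF M(1)] by blast
  have Wc: "W \<subseteq> carrier G" using W by (auto dest: normal_imp_subgroup subgroup.mem_carrier)
  have Mcn: "closed_normal M" using M(1) by (rule open_normal_imp_closed_normal)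
  define Z where "Z = ?U (Suc n) \<inter> M"
  have Z: "open_normal Z" unfolding Z_def using U M(1) by (rule open_normal_Int)
  obtain S where S: "finite S" "S \<subseteq> carrier G" "closed_subgroup_generated G T S = carrier G"
    using fg by (auto simp: topologically_fg_def)
  obtain F where F: "finite F" "closed_subgroup_generated G T F = Z"
    using open_normal_finitely_generated[OF S Z] by metis
  have "open_normal (Z \<inter> ?U n)"
  proof (rule openin_bounded_exponent_abelian[OF Z F(2,1)])
    show "closed_normal (Z \<inter> ?U n)"
      using open_normal_imp_closed_normal[OF Z] Ucn by (rule closed_normal_Int)
    show "0 < e ^ n" using e by simp
    fix x assume x: "x \<in> Z"
    have "x [^] (e ^ n) \<in> Z"
    proof -
      have "x [^] (k::nat) \<in> Z" for k
        using x open_normalD(4,6)[OF Z] by (induction k) (auto intro: subgroup.m_closed)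
      then show ?thesis .
    qed
    moreover have "x [^] (e ^ n) \<in> ?U n"
      by (rule pow_mem_upper_central[OF C W Mcn M(2) MC, where t = 1])
        (use e(2) Wc x n in \<open>auto simp: Z_def simp del: upper_central.simps\<close>)
    ultimately show "x [^] (e ^ n) \<in> Z \<inter> ?U n" by simp
    fix y assume y: "y \<in> Z"
    have "commutator G x y \<in> ?U n" using x y M(2) by (auto simp: Z_def)
    moreover have "commutator G x y \<in> Z"
      using commutator_in_normal(1)[of Z x y] open_normalD[OF Z] x y by auto
    ultimately show "commutator G x y \<in> Z \<inter> ?U n" by simp
  qed auto
  then show ?thesis
    by (rule open_normal_superset) (use closed_normalD(1)[OF Ucn] in auto)
qed

text \<open>Each commutation with an element of \<open>W \<le> A M\<close> moves one step down the lower central series of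
  \<open>A\<close> or of \<open>M\<close>.\<close>

lemma lc_subset_upper_central:
  assumes A: "closed_normal A" and M: "closed_normal M" and D: "closed_normal D"
    and MD: "lc (Suc c) M \<subseteq> D" and W: "W \<subseteq> A <#> M" and W': "W \<lhd> G"
    and x: "x \<in> lc t M" "1 \<le> t" "s = 0 \<or> x \<in> lc s A" and k: "2 * c + 1 \<le> s + t + k"
  shows "x \<in> upper_central (lc (Suc c) A <#> D) W k"
  using x k
proof (induction k arbitrary: x s t)
  case 0
  have up: "lc (Suc c) A \<subseteq> lc (Suc c) A <#> D" "D \<subseteq> lc (Suc c) A <#> D"
    using set_mult_upper[OF closed_normalD(3)[OF closed_normal_lc[OF A]] closed_normalD(3)[OF D]]
    by blast+
  \<comment> \<open>Since \<open>s + t\<close> is at least \<open>2 * c + 1\<close>, one of the two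
    indices exceeds \<open>c\<close>. The value \<open>s = 0\<close> stands for no information about
    \<open>A\<close>.\<close>
  from 0 have "Suc c \<le> t \<or> Suc c \<le> s \<and> x \<in> lc s A" by linarith
  then have "x \<in> lc (Suc c) M \<or> x \<in> lc (Suc c) A"
    using 0(1) lc_antimono[OF M, of "Suc c" t] lc_antimono[OF A, of "Suc c" s] by blast
  then show ?case using up MD by auto
next
  case (Suc k)
  let ?U = "upper_central (lc (Suc c) A <#> D) W k"
  have xc: "x \<in> carrier G" using Suc.prems(1) closed_normalD(4)[OF closed_normal_lc[OF M]] by blast
  have IH: "y \<in> ?U" if "y \<in> lc t' M" "1 \<le> t'" "s' = 0 \<or> y \<in> lc s' A" "s + t < s' + t'" for y s' t'
    using Suc.IH[OF that(1,2,3)] Suc.prems(4) that(4) by simp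
  have "commutator G x w \<in> ?U" if w: "w \<in> W" for w
  proof -
    obtain a m where am: "a \<in> A" "m \<in> M" "w = a \<otimes> m" using subsetD[OF W w] by (auto simp: mem_set_mult)
    have c: "a \<in> carrier G" "m \<in> carrier G" using am closed_normalD(4) A M by auto
    note lcA = closed_normalD(1)[OF closed_normal_lc[OF A]]
      and lcM = closed_normalD(1)[OF closed_normal_lc[OF M]]
    have 1: "commutator G x m \<in> ?U"
    proof (rule IH)
      show "commutator G x m \<in> lc (Suc t) M" using lc_commutator Suc.prems am by simp
      show "s = 0 \<or> commutator G x m \<in> lc s A"
        using Suc.prems(3) commutator_in_normal(1)[OF lcA _ c(2)] by blast
    qed auto
    have 2: "inv m \<otimes> commutator G x a \<otimes> m \<in> ?U"
    proof (rule IH)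
      show "inv m \<otimes> commutator G x a \<otimes> m \<in> lc t M"
        using Suc.prems(1) commutator_in_normal(1)[OF lcM _ c(1)] normal.inv_op_closed1[OF lcM c(2)]
        by blast
      have "commutator G x a \<in> lc (Suc s) A"
      \<comment> \<open>The first commutation with \<open>a \<in> A\<close> enters \<open>A\<close>,
        the first term of its series, by normality of \<open>A\<close>.\<close>
      proof (cases "s = 0")
        case True
        then show ?thesis using commutator_in_normal(2)[OF closed_normalD(1)[OF A] am(1) xc] by simp
      next
        case False
        then show ?thesis using lc_commutator[of s x A a] Suc.prems(3) am(1) by auto
      qed
      then show "Suc s = 0 \<or> inv m \<otimes> commutator G x a \<otimes> m \<in> lc (Suc s) A"
        using normal.inv_op_closed1[OF lcA c(2)] by blast
    qed (use Suc.prems in auto)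
    have "subgroup ?U G"
      using closed_normal_set_mult[OF closed_normal_lc[OF A] D] W'
      by (intro closed_normalD(3) closed_normal_upper_central)
    then show ?thesis
      using 1 2 xc c am(3) by (simp add: commutator_mult_right subgroup.m_closed)
  qed
  then show ?case using xc by simp
qed

text \<open>The classical fact that commutation with the \<open>i\<close>-th lower central term
  lowers the upper central index by \<open>i\<close>, proved by induction on \<open>i\<close> with
  the three subgroups lemma.\<close>

lemma commutator_lc_upper_central:
  assumes C: "closed_normal C" and W: "closed_normal W"
    and i: "1 \<le> i" "i \<le> j" and u: "u \<in> upper_central C W j" "u \<in> W" and g: "g \<in> lc i W"
  shows "commutator G u g \<in> upper_central C W (j - i)"
  using i u g
proof (induction i arbitrary: j u g rule: lc_Suc_induct)
  case one
  then show ?case by (cases j) auto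
next
  case (Suc i)
  let ?U = "upper_central C W"
  have U: "closed_normal (?U k)" for k
    using C closed_normalD(1)[OF W] by (rule closed_normal_upper_central)
  note UD = closed_normalD[OF U]
  have uc: "u \<in> carrier G" using Suc.prems closed_normalD(4)[OF W] by auto
  have Wc: "W \<subseteq> carrier G" and lcc: "lc i W \<subseteq> carrier G"
    using closed_normalD(4)[OF W] closed_normalD(4)[OF closed_normal_lc[OF W]] .
  \<comment> \<open>The elements commuting with \<open>u\<close> modulo the target term form a
    closed subgroup, so only the generating commutators of \<open>lc (Suc i) W\<close> need
    checking.\<close>
  let ?V = "{v \<in> carrier G. \<forall>u'\<in>{u}. commutator G v u' \<in> ?U (j - Suc i)}"
  have "lc (Suc i) W \<subseteq> ?V"
    unfolding lc_Suc[OF Suc.hyps]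
  proof (rule commutator_subgroup_least)
    show "subgroup ?V G" using UD(1) uc by (intro subgroup_Collect_centralize) auto
    show "closedin T ?V" using UD(2) uc by (intro closedin_Collect_centralize) auto
    fix g w assume g: "g \<in> lc i W" and w: "w \<in> W"
    then have c: "g \<in> carrier G" "w \<in> carrier G" using Wc lcc by auto
    have ig: "inv g \<in> lc i W" using g closed_normalD(3)[OF closed_normal_lc[OF W]] by (simp add: subgroup.m_inv_closed)
    have iw: "inv w \<in> W" using w closed_normalD(3)[OF W] by (simp add: subgroup.m_inv_closed)
    interpret N: normal "?U (j - Suc i)" G using UD(1) .
    have j: "j - i = Suc (j - Suc i)" "j = Suc (j - 1)" "i \<le> j - 1" "j - 1 - i = j - Suc i"
      using Suc.prems Suc.hyps by auto
    have ug: "commutator G u (inv g) \<in> ?U (Suc (j - Suc i))"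
      using Suc.IH[OF _ Suc.prems(2,3) ig] Suc.prems(1) j(1) by simp
    have uw: "commutator G u (inv w) \<in> ?U (j - 1)"
      using Suc.prems(2) iw by (subst (asm) j(2)) simp
    have uwW: "commutator G u (inv w) \<in> W"
      using commutator_in_normal(1)[OF closed_normalD(1)[OF W] Suc.prems(3)] c by simp
    \<comment> \<open>The identity is applied to \<open>inv g\<close> and \<open>inv w\<close>, so
      that its conclusion concerns the commutator of \<open>g\<close> and \<open>w\<close>.\<close>
    have "commutator G u (commutator G (inv (inv g)) (inv (inv w))) \<in> ?U (j - Suc i)"
    proof (rule N.commutator_commutator_mod[OF uc])
      show "commutator G (commutator G u (inv g)) (inv w) \<in> ?U (j - Suc i)" using ug iw by simp
      show "commutator G (commutator G u (inv w)) (inv g) \<in> ?U (j - Suc i)"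
        using Suc.IH[OF j(3) uw uwW ig] j(4) by simp
      show "commutator G (commutator G u (inv g)) (commutator G u (inv w)) \<in> ?U (j - Suc i)"
        using ug uwW by simp
    qed (use c in auto)
    then show "commutator G g w \<in> ?V"
      using c uc commutator_mem_swap[OF UD(3) uc, of "commutator G g w" "j - Suc i"] by simp
  qed
  then have "commutator G g u \<in> ?U (j - Suc i)" "g \<in> carrier G" using Suc.prems(4) by auto
  then show ?case using commutator_mem_swap[OF UD(3) uc] by blast
qed

text \<open>At \<open>i = Suc c\<close> the correction term is \<open>C\<close>, so modulo
  \<open>C\<close> the factor \<open>Z\<close> is invisible. In the induction, commutators of
  \<open>lc i A\<close> with \<open>Z\<close> are handled by
  \<open>commutator_lc_upper_central\<close>.\<close>

lemma lc_set_mult_central: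
  assumes C: "closed_normal C" and W: "closed_normal W" and A: "closed_normal A" "A \<subseteq> W"
    and Z: "closed_normal Z" "Z \<subseteq> W" "Z \<subseteq> upper_central C W c"
    and i: "1 \<le> i" "i \<le> Suc c"
  shows "lc i (A <#> Z) \<subseteq> lc i A <#> upper_central C W (Suc c - i)"
  using i
proof (induction i rule: lc_Suc_induct)
  case one
  then show ?case using mono_set_mult[OF order_refl Z(3)] by simp
next
  case (Suc i)
  let ?U = "upper_central C W"
  have U: "closed_normal (?U k)" for k
    using C closed_normalD(1)[OF W] by (rule closed_normal_upper_central)
  let ?V = "lc (Suc i) A <#> ?U (Suc c - Suc i)"
  have V: "closed_normal ?V"
    using A(1) U by (intro closed_normal_set_mult closed_normal_lc)
  note VD = closed_normalD[OF V]
  have up: "lc (Suc i) A \<subseteq> ?V" "?U (c - i) \<subseteq> ?V"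
    using set_mult_upper[OF closed_normalD(3)[OF closed_normal_lc[OF A(1)]] closed_normalD(3)[OF U]]
    by (simp_all del: upper_central.simps)
  show ?case
    unfolding lc_Suc[OF Suc.hyps, of "A <#> Z"]
  proof (rule commutator_subgroup_least)
    fix x p assume "x \<in> lc i (A <#> Z)" and "p \<in> A <#> Z"
    then obtain g u a z where x: "x = g \<otimes> u" "g \<in> lc i A" "u \<in> ?U (Suc c - i)"
      and p: "p = a \<otimes> z" "a \<in> A" "z \<in> Z"
      using Suc.IH Suc.prems by (auto simp: mem_set_mult subset_iff)
    have pW: "p \<in> W" using p A(2) Z(2) closed_normalD(3)[OF W] by (auto intro: subgroup.m_closed)
    have c: "g \<in> carrier G" "u \<in> carrier G" "a \<in> carrier G" "z \<in> carrier G" "p \<in> carrier G"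
      using x(2,3) p(2,3) pW closed_normalD(4)[OF closed_normal_lc[OF A(1)]] closed_normalD(4)[OF U]
        closed_normalD(4)[OF A(1)] closed_normalD(4)[OF Z(1)] closed_normalD(4)[OF W] by blast+
    have "commutator G u p \<in> ?U (c - i)"
      using x(3) pW Suc.prems Suc_diff_le[of i c] by simp
    then have up': "commutator G u p \<in> ?V" using up(2) by blast
    have "g \<in> lc i W" using x(2) lc_mono[OF A(2)] by blast
    then have "commutator G z g \<in> ?U (c - i)"
      using commutator_lc_upper_central[OF C W Suc.hyps, of c z g] Suc.prems p(3) Z by auto
    then have gz: "commutator G g z \<in> ?V"
      using up(2) commutator_mem_swap[OF VD(3), of g z] c by blast
    have ga: "commutator G g a \<in> ?V" using lc_commutator[OF Suc.hyps x(2) p(2)] up(1) by blast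
    have "commutator G g p \<in> ?V"
      unfolding p(1) commutator_mult_right[OF c(3,4,1)]
      using gz ga normal.inv_op_closed1[OF VD(1) c(4)] VD(3) by (simp add: subgroup.m_closed)
    then show "commutator G x p \<in> lc (Suc i) A <#> ?U (Suc c - Suc i)"
      unfolding x(1) commutator_mult_left[OF c(1,2,5)]
      using up' normal.inv_op_closed1[OF VD(1) c(2)] VD(3) by (simp add: subgroup.m_closed)
  qed (use VD in auto)
qed

text \<open>The equation \<open>A <#> Z = N <#> Z\<close> says that \<open>A\<close> and
  \<open>N\<close> agree in the finite quotient by \<open>Z\<close>; it is the notion of closeness
  used for the compactness argument.\<close>

lemma lc_locally_constant_mod:
  assumes fg: "topologically_fg G T" and M: "open_normal M" and D: "closed_normal D"
    and MD: "lc (Suc c) M \<subseteq> D" and N: "closed_normal N"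
  obtains Z where "open_normal Z"
    "\<And>A. \<lbrakk>closed_normal A; A <#> Z = N <#> Z\<rbrakk> \<Longrightarrow> lc (Suc c) N \<subseteq> lc (Suc c) A <#> D"
proof -
  define W where "W = N <#> M"
  have W: "open_normal W" unfolding W_def using closed_normalD(1)[OF N] M by (rule open_normal_set_mult)
  have Mcn: "closed_normal M" and Wcn: "closed_normal W"
    using M W open_normal_imp_closed_normal by auto
  have NW: "N \<subseteq> W" "M \<subseteq> W"
    unfolding W_def
    using set_mult_upper[OF closed_normalD(3)[OF N] closed_normalD(3)[OF Mcn]] by blast+
  \<comment> \<open>This family depends on \<open>N\<close> only through \<open>N <#> M\<close>.
    Intersecting over it gives one base \<open>C\<close>, and hence one \<open>Z\<close> serving all
    nearby \<open>A\<close> at once.\<close>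
  define \<A> where "\<A> = {A. closed_normal A \<and> A <#> M = W}"
  define C where "C = \<Inter>((\<lambda>A. lc (Suc c) A <#> D) ` \<A>)"
  have NA: "N \<in> \<A>" using N by (simp add: \<A>_def W_def)
  have CA: "closed_normal (lc (Suc c) A <#> D)" "D \<subseteq> lc (Suc c) A <#> D"
      "lc (Suc c) A \<subseteq> lc (Suc c) A <#> D" if "closed_normal A" for A
    using closed_normal_set_mult[OF closed_normal_lc[OF that] D]
      set_mult_upper[OF closed_normalD(3)[OF closed_normal_lc[OF that]] closed_normalD(3)[OF D]]
    by auto
  have C: "closed_normal C"
    unfolding C_def using NA CA(1) by (intro closed_normal_Inter) (auto simp: \<A>_def)
  have DC: "D \<subseteq> C" unfolding C_def using CA(2) by (auto simp: \<A>_def)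
  let ?U = "upper_central C W"
  have U: "closed_normal (?U k)" for k
    using C closed_normalD(1)[OF Wcn] by (rule closed_normal_upper_central)
  \<comment> \<open>The defining commutator conditions pass to the intersection of the bases;
    \<open>N \<in> \<A>\<close> supplies membership in the carrier.\<close>
  have Inter_U: "x \<in> ?U k" if "\<And>A. A \<in> \<A> \<Longrightarrow> x \<in> upper_central (lc (Suc c) A <#> D) W k" for x k
    using that
  proof (induction k arbitrary: x)
    case 0
    then show ?case by (auto simp: C_def)
  next
    case (Suc k)
    then show ?case using NA by fastforce
  qed
  \<comment> \<open>Starting with \<open>t = 1\<close> and \<open>s = 0\<close>, the required weight
    \<open>2 * c + 1\<close> is reached after \<open>2 * c\<close> commutations.\<close>
  have "M \<subseteq> ?U (2 * c)"
  proof
    fix x assume x: "x \<in> M"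
    show "x \<in> ?U (2 * c)"
    proof (rule Inter_U)
      fix A assume "A \<in> \<A>"
      then show "x \<in> upper_central (lc (Suc c) A <#> D) W (2 * c)"
        using x Mcn D MD closed_normalD(1)[OF Wcn]
        by (intro lc_subset_upper_central[where t = 1 and s = 0 and M = M]) (auto simp: \<A>_def)
    qed
  qed
  then have "open_normal (?U (2 * c))"
    using open_normal_superset[OF M] closed_normalD(1)[OF U] by blast
  \<comment> \<open>Openness descends one term at a time from index \<open>2 * c\<close> to index
    \<open>c\<close>, the one at which \<open>lc_set_mult_central\<close> applies.\<close>
  then have Uc: "open_normal (?U c)"
  proof (rule inc_induct[of c "2 * c", rotated])
    fix n assume "c \<le> n" "open_normal (?U (Suc n))"
    then show "open_normal (?U n)"
      using open_normal_upper_central_step[OF fg C closed_normalD(1)[OF Wcn] M NW(2)] MD DC by blast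
  qed simp
  define Z where "Z = ?U c \<inter> M"
  have Z: "open_normal Z" unfolding Z_def using Uc M by (rule open_normal_Int)
  note Zcn = open_normal_imp_closed_normal[OF Z]
  show thesis
  proof (rule that[OF Z])
    fix A assume A: "closed_normal A" and AZ: "A <#> Z = N <#> Z"
    have ZM: "Z \<subseteq> M" by (simp add: Z_def)
    have le: "B <#> M \<subseteq> B' <#> M" if "closed_normal B" "closed_normal B'" "B <#> Z = B' <#> Z" for B B'
    proof (rule set_mult_least)
      show "subgroup (B' <#> M) G"
        using closed_normalD(3)[OF closed_normal_set_mult[OF that(2) Mcn]] .
      have "B \<subseteq> B' <#> Z"
        using set_mult_upper(1)[OF closed_normalD(3)[OF that(1)] closed_normalD(3)[OF Zcn]] that(3) by simp
      also have "\<dots> \<subseteq> B' <#> M" using ZM by (intro mono_set_mult) auto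
      finally show "B \<subseteq> B' <#> M" .
      show "M \<subseteq> B' <#> M"
        using set_mult_upper(2)[OF closed_normalD(3)[OF that(2)] closed_normalD(3)[OF Mcn]] .
    qed
    have AM: "A <#> M = W" using le[OF A N AZ] le[OF N A AZ[symmetric]] by (auto simp: W_def)
    then have AA: "A \<in> \<A>" using A by (simp add: \<A>_def)
    have AW: "A \<subseteq> W" using set_mult_upper(1)[OF closed_normalD(3)[OF A] closed_normalD(3)[OF Mcn]] AM by simp
    have "N \<subseteq> A <#> Z"
      using set_mult_upper(1)[OF closed_normalD(3)[OF N] closed_normalD(3)[OF Zcn]] AZ by simp
    then have "lc (Suc c) N \<subseteq> lc (Suc c) (A <#> Z)" by (rule lc_mono)
    also have "\<dots> \<subseteq> lc (Suc c) A <#> ?U (Suc c - Suc c)"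
      using ZM NW(2) by (intro lc_set_mult_central[OF C Wcn A AW Zcn]) (auto simp: Z_def)
    also have "\<dots> \<subseteq> lc (Suc c) A <#> D"
    proof (rule set_mult_least)
      show "subgroup (lc (Suc c) A <#> D) G" using CA(1)[OF A] by (rule closed_normalD(3))
      show "lc (Suc c) A \<subseteq> lc (Suc c) A <#> D" by (rule CA(3)[OF A])
      show "?U (Suc c - Suc c) \<subseteq> lc (Suc c) A <#> D" using AA by (auto simp: C_def)
    qed
    finally show "lc (Suc c) N \<subseteq> lc (Suc c) A <#> D" .
  qed
qed

end

section \<open>Lower bounds for the lower central series\<close>

context profinite_group
begin

lemma normal_perfect_subset_lc:
  assumes A: "closed_normal A" and K: "commutator_subgroup G T A K = K" "K \<subseteq> A" and i: "1 \<le> i"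
  shows "K \<subseteq> lc i A"
  using i
proof (induction i rule: lc_Suc_induct)
  case (Suc i)
  have "K = commutator_subgroup G T A K" using K(1) by simp
  also have "\<dots> \<subseteq> lc (Suc i) A"
  proof (rule commutator_subgroup_least)
    note lcD = closed_normalD[OF closed_normal_lc[OF A]]
    show "subgroup (lc (Suc i) A) G" "closedin T (lc (Suc i) A)" using lcD by auto
    fix x y assume "x \<in> A" "y \<in> K"
    moreover from this have "commutator G y x \<in> lc (Suc i) A"
      using lc_commutator[OF Suc.hyps] Suc.IH by blast
    ultimately show "commutator G x y \<in> lc (Suc i) A"
      using commutator_mem_swap[OF lcD(3)] K(2) closed_normalD(4)[OF A] by blast
  qed
  finally show ?case .
qed (use K in auto)

text \<open>\<open>H\<close> lies in every term of the upper central series over itself, so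
  \<open>lc_set_mult_central\<close> applies with base \<open>H\<close>.\<close>

lemma lc_set_mult_subset:
  assumes N: "closed_normal N" and H: "closed_normal H"
  shows "lc (Suc c) (N <#> H) \<subseteq> lc (Suc c) N <#> H"
proof -
  have "H \<subseteq> upper_central H (carrier G) k" for k
  proof (induction k)
    case (Suc k)
    then show ?case
      using commutator_in_normal(1)[OF closed_normalD(1)[OF H]] closed_normalD(4)[OF H] by auto
  qed simp
  then show ?thesis
    using lc_set_mult_central[OF H closed_normal_carrier N closed_normalD(4)[OF N] H
        closed_normalD(4)[OF H], of c "Suc c"] by simp
qed

lemma commutator_subgroup_eq_one_iff:
  assumes "K \<subseteq> carrier G" "L \<subseteq> carrier G"
  shows "commutator_subgroup G T K L = {\<one>} \<longleftrightarrow> (\<forall>x\<in>K. \<forall>y\<in>L. commutator G x y = \<one>)"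
proof
  assume "\<forall>x\<in>K. \<forall>y\<in>L. commutator G x y = \<one>"
  then have "commutator_subgroup G T K L \<subseteq> {\<one>}"
    using closed_normalD[OF closed_normal_one] by (intro commutator_subgroup_least) auto
  then show "commutator_subgroup G T K L = {\<one>}"
    using subgroup.one_closed[OF commutator_subgroup_closed(1)[OF assms]] by blast
qed (use commutator_in_commutator_subgroup in blast)

text \<open>Below \<open>\<gamma>\<^sub>c\<^sub>+\<^sub>1(N)\<close> take \<open>K\<close> minimal among the closed normal subgroups not
  contained in a suitable open \<open>H\<close>. If \<open>K \<inter> H\<close> is trivial then \<open>K\<close> is perfect, and otherwise
  one can work in the virtually nilpotent group \<open>G / (K \<inter> H)\<close>. Either way \<open>K\<close> survives in
  \<open>\<gamma>\<^sub>c\<^sub>+\<^sub>1\<close> of every small perturbation of \<open>N\<close>.\<close>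

lemma lc_locally_bounded_below:
  assumes fg: "topologically_fg G T" and ff: "Fitting_free G T"
    and vn: "\<And>N. \<lbrakk>closed_normal N; N \<noteq> {\<one>}\<rbrakk> \<Longrightarrow> \<exists>M. open_normal M \<and> lc (Suc c) M \<subseteq> N"
    and N: "closed_normal N" "lc (Suc c) N \<noteq> {\<one>}"
  obtains Z M where "open_normal Z" "open_normal M"
    "\<And>A. \<lbrakk>closed_normal A; A <#> Z = N <#> Z\<rbrakk> \<Longrightarrow> lc (Suc c) M \<subseteq> lc (Suc c) A"
proof -
  have L: "closed_normal (lc (Suc c) N)" using N(1) by (rule closed_normal_lc)
  obtain H where H: "open_normal H" "\<not> lc (Suc c) N \<subseteq> H"
    using open_normal_not_superset[OF L N(2)] .
  note HD = open_normalD[OF H(1)] and Hcn = open_normal_imp_closed_normal[OF H(1)]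
  obtain K where K: "closed_normal K" "K \<subseteq> lc (Suc c) N" "\<not> K \<subseteq> H"
    and min: "\<And>M. \<lbrakk>closed_normal M; M \<subseteq> K; M \<noteq> K\<rbrakk> \<Longrightarrow> M \<subseteq> H"
    using minimal_closed_normal_not_subset[OF L HD(2) H(2)] by metis
  note KD = closed_normalD[OF K(1)]
  define D where "D = K \<inter> H"
  have D: "closed_normal D" unfolding D_def using K(1) Hcn by (rule closed_normal_Int)
  have K1: "K \<noteq> {\<one>}" using K(3) HD(6) by auto
  show thesis
  proof (cases "D = {\<one>}")
    case True
    have small: "M = {\<one>}" if "closed_normal M" "M \<subseteq> K" "M \<noteq> K" for M
      using min[OF that] that closed_normalD(5)[OF that(1)] True by (auto simp: D_def)
    obtain M where M: "open_normal M" "lc (Suc c) M \<subseteq> K" using vn[OF K(1) K1] by blast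
    have nonab: "\<exists>x\<in>K. \<exists>y\<in>K. x \<otimes> y \<noteq> y \<otimes> x"
      using ff K(1) K1 unfolding Fitting_free_def closed_normal_def by blast
    show thesis
    proof (rule that[OF H(1) M(1)])
      fix A assume A: "closed_normal A" and AH: "A <#> H = N <#> H"
      note AD = closed_normalD[OF A]
      have sub: "commutator_subgroup G T A K \<subseteq> K" "commutator_subgroup G T A K \<subseteq> A"
        using commutator_subgroup_subset[OF K(1) AD(4)] commutator_subgroup_subset[OF A KD(4)] by auto
      have "commutator_subgroup G T A K = K"
      proof (rule ccontr)
        \<comment> \<open>Then \<open>A\<close> centralizes \<open>K\<close>, and so does
          \<open>H\<close>, because \<open>K \<inter> H\<close> is trivial. As
          \<open>K \<subseteq> N \<subseteq> A <#> H\<close>, the group \<open>K\<close> would be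
          abelian, against Fitting-freeness.\<close>
        assume "commutator_subgroup G T A K \<noteq> K"
        then have "commutator_subgroup G T A K = {\<one>}"
          using small closed_normal_commutator_subgroup AD(1) KD(1) sub(1) by blast
        then have ak: "commutator G a k = \<one>" if "a \<in> A" "k \<in> K" for a k
          using that commutator_subgroup_eq_one_iff[OF AD(4) KD(4)] by blast
        have hk: "commutator G h k = \<one>" if "h \<in> H" "k \<in> K" for h k
        proof -
          have "commutator G h k \<in> K \<inter> H"
            using commutator_in_normal(1)[OF HD(1) that(1)] commutator_in_normal(2)[OF KD(1) that(2)]
              that HD(5) KD(4) by blast
          then show ?thesis using True unfolding D_def by blast
        qed
        have "x \<otimes> y = y \<otimes> x" if "x \<in> K" "y \<in> K" for x y
        proof -
          have "K \<subseteq> N" using K(2) lc_subset[OF N(1)] by blast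
          also have "\<dots> \<subseteq> A <#> H"
            using set_mult_upper(1)[OF closed_normalD(3)[OF N(1)] HD(4)] AH by simp
          finally have "x \<in> A <#> H" using that(1) by blast
          then obtain a h where x: "a \<in> A" "h \<in> H" "x = a \<otimes> h"
            by (auto simp: mem_set_mult)
          have c: "a \<in> carrier G" "h \<in> carrier G" "y \<in> carrier G"
            using x(1,2) that(2) AD(4) HD(5) KD(4) by auto
          then have "commutator G x y = \<one>"
            using x ak[OF x(1) that(2)] hk[OF x(2) that(2)] by (simp add: commutator_mult_left)
          then show ?thesis using commutator_eq_one_iff[of x y] that KD(4) by blast
        qed
        then show False using nonab by blast
      qed
      moreover from this have "K \<subseteq> A" using sub(2) by simp
      ultimately have "K \<subseteq> lc (Suc c) A" using normal_perfect_subset_lc[OF A] by simp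
      then show "lc (Suc c) M \<subseteq> lc (Suc c) A" using M(2) by blast
    qed
  next
    case False
    then obtain M where M: "open_normal M" "lc (Suc c) M \<subseteq> D" using vn[OF D] by blast
    obtain Z where Z: "open_normal Z"
      "\<And>A. \<lbrakk>closed_normal A; A <#> Z = N <#> Z\<rbrakk> \<Longrightarrow> lc (Suc c) N \<subseteq> lc (Suc c) A <#> D"
      using lc_locally_constant_mod[OF fg M(1) D M(2) N(1)] by blast
    show thesis
    proof (rule that[OF Z(1) M(1)])
      fix A assume A: "closed_normal A" and AZ: "A <#> Z = N <#> Z"
      let ?L = "lc (Suc c) A"
      have Lcn: "closed_normal ?L" using A by (rule closed_normal_lc)
      have "K \<subseteq> ?L <#> D" using Z(2)[OF A AZ] K(2) by blast
      then have KL: "K \<subseteq> (?L \<inter> K) <#> D"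
        using KD(1) closed_normalD(4)[OF Lcn] by (intro Int_set_mult_modular) (auto simp: D_def)
      \<comment> \<open>Otherwise minimality puts \<open>?L \<inter> K\<close> into
        \<open>H\<close>; together with \<open>D \<subseteq> H\<close> the modular law would then
        force \<open>K \<subseteq> H\<close>.\<close>
      have "?L \<inter> K = K"
      proof (rule ccontr)
        assume "?L \<inter> K \<noteq> K"
        then have "?L \<inter> K \<subseteq> H" using min[OF closed_normal_Int[OF Lcn K(1)]] by blast
        then have "(?L \<inter> K) <#> D \<subseteq> H" using HD(4) by (intro set_mult_least) (auto simp: D_def)
        then show False using KL K(3) by blast
      qed
      then show "lc (Suc c) M \<subseteq> ?L" using M(2) by (auto simp: D_def)
    qed
  qed
qed

text \<open>A compactness argument on the space of closed normal subgroups: if no \<open>M\<close> served all of the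
  \<open>N\<close> in question, then a descending sequence of open normal subgroups \<open>V i\<close> without a common \<open>M\<close> would converge to
  a closed normal subgroup contradicting the local statement.\<close>

lemma lc_uniformly_bounded_below:
  assumes fg: "topologically_fg G T" and ff: "Fitting_free G T"
    and vn: "\<And>N. \<lbrakk>closed_normal N; N \<noteq> {\<one>}\<rbrakk> \<Longrightarrow> \<exists>M. open_normal M \<and> lc (Suc c) M \<subseteq> N"
    and H: "open_normal H"
  obtains M where "open_normal M"
    "\<And>N. \<lbrakk>closed_normal N; \<not> lc (Suc c) N \<subseteq> H\<rbrakk> \<Longrightarrow> lc (Suc c) M \<subseteq> lc (Suc c) N"
proof (rule ccontr)
  assume no: "\<not> thesis"
  define \<N> where "\<N> = {N. closed_normal N \<and> \<not> lc (Suc c) N \<subseteq> H}"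
  define good where "good \<F> \<longleftrightarrow> (\<exists>M. open_normal M \<and> (\<forall>N\<in>\<F>. lc (Suc c) M \<subseteq> lc (Suc c) N))" for \<F>
  have not_good: "\<not> good \<N>" using no that unfolding good_def \<N>_def by blast
  have good_mono: "good \<F>" if "good \<F>'" "\<F> \<subseteq> \<F>'" for \<F> \<F>'
    using that unfolding good_def by (meson subsetD)
  have good_Un: "good (\<Union>\<S>)" if "finite \<S>" "\<And>\<F>. \<F> \<in> \<S> \<Longrightarrow> good \<F>" for \<S>
    using that
  proof (induction \<S> rule: finite_induct)
    case empty
    then show ?case using open_normal_carrier by (auto simp: good_def)
  next
    case (insert \<F> \<S>)
    then obtain M1 M2 where M: "open_normal M1" "\<forall>N\<in>\<F>. lc (Suc c) M1 \<subseteq> lc (Suc c) N"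
      "open_normal M2" "\<forall>N\<in>\<Union>\<S>. lc (Suc c) M2 \<subseteq> lc (Suc c) N"
      unfolding good_def by (metis insertI1 insertI2)
    have "lc (Suc c) (M1 \<inter> M2) \<subseteq> lc (Suc c) M1" "lc (Suc c) (M1 \<inter> M2) \<subseteq> lc (Suc c) M2"
      by (intro lc_mono; simp)+
    then have "\<forall>N\<in>\<Union>(insert \<F> \<S>). lc (Suc c) (M1 \<inter> M2) \<subseteq> lc (Suc c) N"
      using M by (metis Union_insert UnE subset_trans)
    then show ?case unfolding good_def using open_normal_Int[OF M(1,3)] by blast
  qed
  obtain U0 where U0: "\<And>i. open_normal (U0 i)" "decseq U0" "\<And>V. open_normal V \<Longrightarrow> \<exists>i. U0 i \<subseteq> V"
    using countable_open_normal_base[OF fg] by blast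
  \<comment> \<open>Keeping every \<open>U i\<close> inside \<open>H\<close> makes the limit
    subgroup inherit a non-trivial \<open>lc (Suc c)\<close>.\<close>
  define U where "U i = U0 i \<inter> H" for i
  have U: "open_normal (U i)" "U i \<subseteq> H" for i using open_normal_Int[OF U0(1) H] by (auto simp: U_def)
  have Udec: "U j \<subseteq> U i" if "i \<le> j" for i j using U0(2) that by (auto simp: U_def decseq_def)
  have Ubase: "\<exists>i. U i \<subseteq> V" if "open_normal V" for V using U0(3)[OF that] by (auto simp: U_def)
  note Ucn = open_normal_imp_closed_normal[OF U(1)]
  \<comment> \<open>The members of \<open>\<N>\<close> with prescribed image in
    \<open>G / U i\<close>: balls in the space of closed normal subgroups.\<close>
  define \<B> where "\<B> i V = {N \<in> \<N>. N <#> U i = V}" for i V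
  have absorb: "(N <#> U j) <#> U i = N <#> U i" if "closed_normal N" "i \<le> j" for N i j
  proof
    note ND = closed_normalD[OF that(1)] and UD = open_normalD[OF U(1)]
    have P: "subgroup (N <#> U i) G" by (rule closed_normalD(3)[OF closed_normal_set_mult[OF that(1) Ucn]])
    have le: "N <#> U j \<subseteq> N <#> U i" using Udec[OF that(2)] by (intro mono_set_mult) auto
    show "(N <#> U j) <#> U i \<subseteq> N <#> U i"
      using set_mult_least[OF P le set_mult_upper(2)[OF ND(3) UD(4)]] .
    show "N <#> U i \<subseteq> (N <#> U j) <#> U i"
      using set_mult_upper(1)[OF ND(3) UD(4)] by (intro mono_set_mult) auto
  qed
  have finite_over: "finite {V. \<exists>N. closed_normal N \<and> V = N <#> U i}" for i
  proof (rule finite_subset)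
    show "{V. \<exists>N. closed_normal N \<and> V = N <#> U i} \<subseteq> Union ` Pow (rcosets (U i))"
    proof
      fix V assume "V \<in> {V. \<exists>N. closed_normal N \<and> V = N <#> U i}"
      then obtain N where N: "closed_normal N" "V = N <#> U i" by auto
      have "V = U i <#> N"
        using N(2) commut_normal[OF closed_normalD(3)[OF N(1)] open_normalD(1)[OF U(1)]] by simp
      also have "\<dots> = \<Union>((\<lambda>n. U i #> n) ` N)" by (auto simp: set_mult_def r_coset_def)
      finally have "V = \<Union>((\<lambda>n. U i #> n) ` N)" .
      moreover have "(\<lambda>n. U i #> n) ` N \<in> Pow (rcosets (U i))"
        using closed_normalD(4)[OF N(1)] by (auto simp: RCOSETS_def)
      ultimately show "V \<in> Union ` Pow (rcosets (U i))" by (rule image_eqI)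
    qed
    show "finite (Union ` Pow (rcosets (U i)))"
      using finite_rcosets_open[OF open_normalD(4,2)[OF U(1)]] by simp
  qed
  \<comment> \<open>A ball splits into finitely many balls of the next level; if all were good, so
    would be their union. Choosing bad balls repeatedly follows an infinite branch as in Koenig's
    lemma.\<close>
  have step: "\<exists>V'. \<not> good (\<B> (Suc i) V') \<and> V' <#> U i = V" if V: "\<not> good (\<B> i V)" for i V
  proof (rule ccontr)
    assume no: "\<nexists>V'. \<not> good (\<B> (Suc i) V') \<and> V' <#> U i = V"
    let ?\<V> = "{V'. (\<exists>N. closed_normal N \<and> V' = N <#> U (Suc i)) \<and> V' <#> U i = V}"
    have "good (\<Union>(\<B> (Suc i) ` ?\<V>))"
    proof (rule good_Un)
      show "finite (\<B> (Suc i) ` ?\<V>)"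
        by (intro finite_imageI finite_subset[OF _ finite_over[of "Suc i"]]) blast
    qed (use no in blast)
    moreover have "\<B> i V \<subseteq> \<Union>(\<B> (Suc i) ` ?\<V>)"
    proof
      fix N assume "N \<in> \<B> i V"
      then have N: "N \<in> \<N>" "closed_normal N" "N <#> U i = V" by (auto simp: \<B>_def \<N>_def)
      then have "N <#> U (Suc i) \<in> ?\<V>" "N \<in> \<B> (Suc i) (N <#> U (Suc i))"
        using absorb[OF N(2), of i "Suc i"] by (auto simp: \<B>_def)
      then show "N \<in> \<Union>(\<B> (Suc i) ` ?\<V>)" by blast
    qed
    ultimately have "good (\<B> i V)" by (rule good_mono)
    then show False using V by simp
  qed
  have start: "\<exists>V. \<not> good (\<B> 0 V)"
  proof (rule ccontr)
    assume "\<nexists>V. \<not> good (\<B> 0 V)"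
    then have "good (\<Union>(\<B> 0 ` {V. \<exists>N. closed_normal N \<and> V = N <#> U 0}))"
      using finite_over[of 0] by (intro good_Un finite_imageI) auto
    moreover have "\<N> \<subseteq> \<Union>(\<B> 0 ` {V. \<exists>N. closed_normal N \<and> V = N <#> U 0})"
      by (auto simp: \<B>_def \<N>_def)
    ultimately have "good \<N>" by (rule good_mono)
    then show False using not_good by simp
  qed
  obtain V where V: "\<And>i. \<not> good (\<B> i (V i))" "\<And>i. V (Suc i) <#> U i = V i"
    using dependent_nat_choice[of "\<lambda>i V. \<not> good (\<B> i V)" "\<lambda>i V V'. V' <#> U i = V"] start step by metis
  have repr: "\<exists>N. N \<in> \<N> \<and> closed_normal N \<and> N <#> U i = V i" for i
  proof -
    have "\<B> i (V i) \<noteq> {}" using V(1)[of i] open_normal_carrier by (auto simp: good_def)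
    then show ?thesis by (auto simp: \<B>_def \<N>_def)
  qed
  have Vcn: "closed_normal (V i)" for i
    using repr[of i] closed_normal_set_mult[OF _ Ucn] by metis
  have UV: "U i \<subseteq> V i" for i
    using repr[of i] set_mult_upper(2)[OF closed_normalD(3) open_normalD(4)[OF U(1)]] by metis
  have VU: "V j <#> U i = V i" if "i \<le> j" for i j
    using that
  proof (induction j rule: dec_induct)
    case base
    show ?case
    proof
      show "V i <#> U i \<subseteq> V i"
        using closed_normalD(3)[OF Vcn] UV by (intro set_mult_least) auto
      show "V i \<subseteq> V i <#> U i"
        using set_mult_upper(1)[OF closed_normalD(3)[OF Vcn] open_normalD(4)[OF U(1)]] .
    qed
  next
    case (step j)
    obtain N where N: "closed_normal N" "N <#> U (Suc j) = V (Suc j)" using repr by blast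
    have "V j = N <#> U j" using V(2)[of j] N absorb[OF N(1), of j "Suc j"] by simp
    then show ?case using step.IH step.hyps N(2) absorb[OF N(1), of i j] absorb[OF N(1), of i "Suc j"] by simp
  qed
  have Vdec: "V j \<subseteq> V i" if "i \<le> j" for i j
    using VU[OF that] set_mult_upper(1)[OF closed_normalD(3)[OF Vcn] open_normalD(4)[OF U(1)]] by metis
  define N where "N = (\<Inter>i. V i)"
  have N: "closed_normal N" unfolding N_def using Vcn by (intro closed_normal_Inter) auto
  \<comment> \<open>The branch really converges to \<open>N\<close>: each \<open>V i\<close> is
    contained in all \<open>U i <#> V (i + k)\<close>, and \<open>Inter_set_mult_decseq\<close>
    moves the intersection inside the product.\<close>
  have NU: "N <#> U i = V i" for i
  proof
    show "N <#> U i \<subseteq> V i"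
      using closed_normalD(3)[OF Vcn] UV by (intro set_mult_least) (auto simp: N_def)
    have shift: "(\<Inter>k. V (i + k)) = N"
    proof
      have "V (i + k) \<subseteq> V k" for k by (rule Vdec) simp
      then show "(\<Inter>k. V (i + k)) \<subseteq> N" unfolding N_def by blast
    qed (auto simp: N_def)
    have "V i \<subseteq> (\<Inter>k. U i <#> V (i + k))"
      using VU[of i] commut_normal[OF closed_normalD(3)[OF Vcn] open_normalD(1)[OF U(1)]] by auto
    also have "\<dots> \<subseteq> U i <#> (\<Inter>k. V (i + k))"
      using Vcn Vdec by (intro Inter_set_mult_decseq Ucn) (auto simp: decseq_def)
    finally show "V i \<subseteq> N <#> U i"
      unfolding shift using commut_normal[OF closed_normalD(3)[OF N] open_normalD(1)[OF U(1)]] by simp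
  qed
  \<comment> \<open>Otherwise a member \<open>N'\<close> of the level-zero ball lies in
    \<open>N <#> H\<close>, so \<open>lc (Suc c) N'\<close> would lie in \<open>H\<close>, contrary
    to \<open>N' \<in> \<N>\<close>.\<close>
  have "lc (Suc c) N \<noteq> {\<one>}"
  proof
    assume triv: "lc (Suc c) N = {\<one>}"
    obtain N' where N': "N' \<in> \<N>" "closed_normal N'" "N' <#> U 0 = V 0" using repr by blast
    have "N' \<subseteq> N <#> U 0"
      using set_mult_upper(1)[OF closed_normalD(3)[OF N'(2)] open_normalD(4)[OF U(1)], of 0] NU[of 0] N'(3) by simp
    also have "\<dots> \<subseteq> N <#> H" using U(2) by (intro mono_set_mult) auto
    finally have "lc (Suc c) N' \<subseteq> lc (Suc c) (N <#> H)" by (rule lc_mono)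
    also have "\<dots> \<subseteq> {\<one>} <#> H"
      using lc_set_mult_subset[OF N open_normal_imp_closed_normal[OF H], of c] triv by simp
    also have "\<dots> = H" using open_normalD(5)[OF H] by (auto simp: set_mult_def subset_iff)
    finally show False using N'(1) by (simp add: \<N>_def)
  qed
  then obtain Z M where ZM: "open_normal Z" "open_normal M"
    "\<And>A. \<lbrakk>closed_normal A; A <#> Z = N <#> Z\<rbrakk> \<Longrightarrow> lc (Suc c) M \<subseteq> lc (Suc c) A"
    using lc_locally_bounded_below[OF fg ff vn N] by blast
  \<comment> \<open>At this level every member of the ball agrees with \<open>N\<close> modulo
    \<open>Z\<close>, so the whole ball is good, contradicting its choice.\<close>
  obtain i where i: "U i \<subseteq> Z" using Ubase[OF ZM(1)] by blast
  have "lc (Suc c) M \<subseteq> lc (Suc c) A" if "A \<in> \<B> i (V i)" for A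
  proof (rule ZM(3))
    show A: "closed_normal A" using that by (auto simp: \<B>_def \<N>_def)
    have AU: "A <#> U i = N <#> U i" using that NU by (auto simp: \<B>_def)
    note Zcn = open_normal_imp_closed_normal[OF ZM(1)]
    have "B <#> Z = (B <#> U i) <#> Z" if B: "closed_normal B" for B
    proof
      note BD = closed_normalD(3)[OF B]
      show "B <#> Z \<subseteq> (B <#> U i) <#> Z"
        using set_mult_upper(1)[OF BD open_normalD(4)[OF U(1)]] by (intro mono_set_mult) auto
      have "B <#> U i \<subseteq> B <#> Z" using i by (intro mono_set_mult) auto
      then show "(B <#> U i) <#> Z \<subseteq> B <#> Z"
        using set_mult_least[OF closed_normalD(3)[OF closed_normal_set_mult[OF B Zcn]]]
          set_mult_upper(2)[OF BD open_normalD(4)[OF ZM(1)]] by blast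
    qed
    then show "A <#> Z = N <#> Z" using A N AU by metis
  qed
  then have "good (\<B> i (V i))" using ZM(2) unfolding good_def by blast
  then show False using V(1) by blast
qed

end

section \<open>The characterization\<close>

context profinite_group
begin

lemma JNN_sequence_iff:
  "JNN_sequence c G T H \<longleftrightarrow>
     (\<forall>n. open_normal (H n)) \<and> (\<forall>n. H (Suc n) \<subset> H n) \<and> (\<Inter>n. H n) = {\<one>} \<and>
     (\<forall>N n. open_normal N \<longrightarrow> lc (Suc c) N \<subseteq> H n \<or> lc (Suc c) (H (Suc n)) \<subseteq> lc (Suc c) N)"
proof -
  have shift: "(\<forall>N n. N \<lhd> G \<and> openin T N \<and> 1 \<le> n \<longrightarrow> P N (n - 1) n) \<longleftrightarrow>
      (\<forall>N n. open_normal N \<longrightarrow> P N n (Suc n))" (is "?L \<longleftrightarrow> ?R") for P :: "'a set \<Rightarrow> nat \<Rightarrow> nat \<Rightarrow> bool"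
  proof
    show ?R if ?L
      unfolding open_normal_def
    proof (intro allI impI)
      fix N and n :: nat assume "N \<lhd> G \<and> openin T N"
      then show "P N n (Suc n)" using \<open>?L\<close>[rule_format, of N "Suc n"] by simp
    qed
    show ?L if ?R
    proof (intro allI impI)
      fix N and n :: nat assume "N \<lhd> G \<and> openin T N \<and> 1 \<le> n"
      then show "P N (n - 1) n" using \<open>?R\<close>[rule_format, of N "n - 1"] by (simp add: open_normal_def)
    qed
  qed
  show ?thesis
    unfolding JNN_sequence_def shift[of "\<lambda>N m n. lc (c + 1) N \<subseteq> H m \<or> lc (c + 1) (H n) \<subseteq> lc (c + 1) N"]
    by (simp add: open_normal_def)
qed

lemma infinite_carrier_strict_chain:
  fixes H :: "nat \<Rightarrow> 'a set"
  assumes "\<And>n. H (Suc n) \<subset> H n" "\<And>n. H n \<subseteq> carrier G"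
  shows "infinite (carrier G)"
proof
  assume "finite (carrier G)"
  then have fin: "finite (H n)" for n using assms(2) finite_subset by blast
  have "card (H n) + n \<le> card (H 0)" for n
  proof (induction n)
    case (Suc n)
    then show ?case using psubset_card_mono[OF fin assms(1), of n] by simp
  qed simp
  from this[of "Suc (card (H 0))"] show False by simp
qed

lemma open_one_imp_finite:
  assumes "open_normal {\<one>}"
  shows "finite (carrier G)"
proof -
  have "finite (rcosets {\<one>})" using finite_rcosets_open open_normalD[OF assms] by blast
  moreover have "rcosets {\<one>} = (\<lambda>x. {x}) ` carrier G" by (auto simp: RCOSETS_def r_coset_def)
  ultimately show ?thesis by (auto dest!: finite_imageD)
qed

text \<open>The alternative in the sequence concerns open subgroups only, so it is applied to the
  open subgroups \<open>N <#> H k\<close>, whose intersection is \<open>N\<close> by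
  compactness.\<close>

lemma JNN_sequence_bounds_lc:
  assumes ff: "Fitting_free G T" and H: "JNN_sequence c G T H" and N: "closed_normal N" "N \<noteq> {\<one>}"
  obtains n where "lc (Suc c) (H n) \<subseteq> N"
proof -
  have Ho: "\<And>n. open_normal (H n)" and dec: "\<And>n. H (Suc n) \<subset> H n" and inter: "(\<Inter>n. H n) = {\<one>}"
    and alt: "\<And>N n. open_normal N \<Longrightarrow> lc (Suc c) N \<subseteq> H n \<or> lc (Suc c) (H (Suc n)) \<subseteq> lc (Suc c) N"
    using H by (auto simp: JNN_sequence_iff)
  note Hcn = open_normal_imp_closed_normal[OF Ho]
  have L: "closed_normal (lc (Suc c) N)" using N(1) by (rule closed_normal_lc)
  have "lc (Suc c) N \<noteq> {\<one>}" using Fitting_free_lc_nontrivial[OF ff N] .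
  then have "\<not> lc (Suc c) N \<subseteq> (\<Inter>n. H n)" unfolding inter using closed_normalD(5)[OF L] by blast
  then obtain n where n: "\<not> lc (Suc c) N \<subseteq> H n" by blast
  have "lc (Suc c) (H (Suc n)) \<subseteq> N <#> H k" for k
  proof -
    have NH: "open_normal (N <#> H k)" using closed_normalD(1)[OF N(1)] Ho by (rule open_normal_set_mult)
    have "N \<subseteq> N <#> H k" using set_mult_upper(1)[OF closed_normalD(3)[OF N(1)] open_normalD(4)[OF Ho]] .
    then have "lc (Suc c) N \<subseteq> lc (Suc c) (N <#> H k)" by (rule lc_mono)
    then have "\<not> lc (Suc c) (N <#> H k) \<subseteq> H n" using n by blast
    then have "lc (Suc c) (H (Suc n)) \<subseteq> lc (Suc c) (N <#> H k)" using alt[OF NH] by blast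
    also have "\<dots> \<subseteq> N <#> H k" using NH by (intro lc_subset open_normal_imp_closed_normal)
    finally show ?thesis .
  qed
  then have "lc (Suc c) (H (Suc n)) \<subseteq> (\<Inter>k. N <#> H k)" by blast
  also have "\<dots> \<subseteq> N <#> (\<Inter>k. H k)"
    using dec by (intro Inter_set_mult_decseq N Hcn decseq_SucI) blast
  also have "\<dots> = N" unfolding inter using closed_normalD(4)[OF N(1)] by (auto simp: set_mult_def subset_iff)
  finally show thesis by (rule that)
qed

lemma JNN_sequence_imp_JNNF:
  assumes ff: "Fitting_free G T" and H: "JNN_sequence c G T H"
  shows "JNNF c G T"
  unfolding JNNF_iff
proof (intro conjI allI impI)
  have Ho: "\<And>n. open_normal (H n)" and dec: "\<And>n. H (Suc n) \<subset> H n"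
    using H by (auto simp: JNN_sequence_iff)
  show "\<not> virtually_nilpotent c G T"
  proof
    assume "virtually_nilpotent c G T"
    then obtain M where M: "open_normal M" "lc (Suc c) M = {\<one>}" by (auto simp: virtually_nilpotent_iff)
    \<comment> \<open>A trivial open subgroup would make \<open>G\<close> finite, which the strictly
      descending chain excludes.\<close>
    then have "M = {\<one>}"
      using Fitting_free_lc_nontrivial[OF ff open_normal_imp_closed_normal[OF M(1)]] by blast
    then have "finite (carrier G)" using open_one_imp_finite M(1) by simp
    then show False using infinite_carrier_strict_chain[of H] dec open_normalD(5)[OF Ho] by blast
  qed
  fix N assume "closed_normal N \<and> N \<noteq> {\<one>}"
  then show "\<exists>M. open_normal M \<and> lc (Suc c) M \<subseteq> N"
    using JNN_sequence_bounds_lc[OF ff H] Ho by metis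
qed

lemma JNNF_imp_JNN_sequence:
  assumes fg: "topologically_fg G T" and ff: "Fitting_free G T" and J: "JNNF c G T"
  shows "\<exists>H. JNN_sequence c G T H"
proof -
  have nv: "\<not> virtually_nilpotent c G T"
    and vn: "\<And>N. \<lbrakk>closed_normal N; N \<noteq> {\<one>}\<rbrakk> \<Longrightarrow> \<exists>M. open_normal M \<and> lc (Suc c) M \<subseteq> N"
    using J by (auto simp: JNNF_iff)
  obtain U where U: "\<And>i. open_normal (U i)" "decseq U" "\<And>V. open_normal V \<Longrightarrow> \<exists>i. U i \<subseteq> V"
    using countable_open_normal_base[OF fg] by blast
  \<comment> \<open>The bound by \<open>U n\<close> is what makes the intersection of the resulting
    sequence trivial.\<close>
  define P where "P n H H' \<longleftrightarrow> H' \<subset> H \<and> H' \<subseteq> U n \<and>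
    (\<forall>N. open_normal N \<longrightarrow> lc (Suc c) N \<subseteq> H \<or> lc (Suc c) H' \<subseteq> lc (Suc c) N)" for n H H'
  have step: "\<exists>H'. open_normal H' \<and> P n H H'" if H: "open_normal H" for n H
  proof -
    obtain M where M: "open_normal M"
      "\<And>N. \<lbrakk>closed_normal N; \<not> lc (Suc c) N \<subseteq> H\<rbrakk> \<Longrightarrow> lc (Suc c) M \<subseteq> lc (Suc c) N"
      using lc_uniformly_bounded_below[OF fg ff vn H] by blast
    \<comment> \<open>Needed for strict descent: a non-trivial \<open>H\<close> is not contained in
      some open normal \<open>V\<close>, with which it is then intersected.\<close>
    have "H \<noteq> {\<one>}"
    proof
      assume "H = {\<one>}"
      moreover have "lc (Suc c) {\<one>} = {\<one>}"
        using lc_subset[OF closed_normal_one] closed_normalD(5)[OF closed_normal_lc[OF closed_normal_one]] by blast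
      ultimately have "open_normal H \<and> lc (Suc c) H = {\<one>}" using H by simp
      then show False using nv unfolding virtually_nilpotent_iff by blast
    qed
    then obtain V where V: "open_normal V" "\<not> H \<subseteq> V"
      using open_normal_not_superset[OF open_normal_imp_closed_normal[OF H]] by blast
    let ?H = "H \<inter> V \<inter> U n \<inter> M"
    have "open_normal ?H" using H V(1) U(1) M(1) by (intro open_normal_Int)
    moreover have "lc (Suc c) ?H \<subseteq> lc (Suc c) M" by (rule lc_mono) simp
    then have "lc (Suc c) N \<subseteq> H \<or> lc (Suc c) ?H \<subseteq> lc (Suc c) N" if "open_normal N" for N
      using M(2)[OF open_normal_imp_closed_normal[OF that]] by (meson subset_trans)
    then have "P n H ?H" unfolding P_def using V(2) by auto
    ultimately show ?thesis by blast
  qed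
  obtain H where H: "\<And>n. open_normal (H n)" "\<And>n. P n (H n) (H (Suc n))"
    using dependent_nat_choice[of "\<lambda>_. open_normal" P] open_normal_carrier step by metis
  have "(\<Inter>n. H n) = {\<one>}"
  proof
    show "{\<one>} \<subseteq> (\<Inter>n. H n)" using open_normalD(6)[OF H(1)] by auto
    show "(\<Inter>n. H n) \<subseteq> {\<one>}"
    proof (rule subsetI, rule ccontr)
      fix x assume x: "x \<in> (\<Inter>n. H n)" and "x \<notin> {\<one>}"
      then obtain V where V: "open_normal V" "x \<notin> V"
        using open_normal_separating[of x] open_normalD(5)[OF H(1)] by blast
      obtain i where "U i \<subseteq> V" using U(3)[OF V(1)] by blast
      moreover have "x \<in> U i" using x H(2)[of i] by (auto simp: P_def)
      ultimately show False using V(2) by blast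
    qed
  qed
  then have "JNN_sequence c G T H"
    unfolding JNN_sequence_iff using H(1) H(2)[unfolded P_def] by simp
  then show ?thesis by blast
qed

text \<open>Every non-trivial closed normal subgroup contains some \<open>lc (Suc c) (H n)\<close>,
  so finite index of these makes it open. Conversely these terms are themselves non-trivial closed
  normal subgroups.\<close>

lemma JNN_sequence_just_infinite_iff:
  assumes ff: "Fitting_free G T" and H: "JNN_sequence c G T H"
  shows "just_infinite G T \<longleftrightarrow> (\<forall>n. finite_index G (lc (Suc c) (H n)))"
proof
  have Ho: "\<And>n. open_normal (H n)" and dec: "\<And>n. H (Suc n) \<subset> H n"
    using H by (auto simp: JNN_sequence_iff)
  note Hcn = open_normal_imp_closed_normal[OF Ho]
  show "\<forall>n. finite_index G (lc (Suc c) (H n))" if J: "just_infinite G T"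
  proof
    fix n
    have "H n \<noteq> {\<one>}" using dec[of n] open_normalD(6)[OF Ho, of "Suc n"] by auto
    then have "lc (Suc c) (H n) \<noteq> {\<one>}" using Fitting_free_lc_nontrivial[OF ff Hcn] by blast
    then show "finite_index G (lc (Suc c) (H n))"
      using J closed_normal_lc[OF Hcn, of "Suc c" n]
      unfolding just_infinite_def finite_index_def closed_normal_def by (simp add: FactGroup_def)
  qed
  assume fi: "\<forall>n. finite_index G (lc (Suc c) (H n))"
  have "finite (carrier (G Mod N))" if N: "N \<lhd> G" "closedin T N" "N \<noteq> {\<one>}" for N
  proof -
    have Ncn: "closed_normal N" using N by (simp add: closed_normal_def)
    obtain n where n: "lc (Suc c) (H n) \<subseteq> N" using JNN_sequence_bounds_lc[OF ff H Ncn N(3)] by blast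
    let ?L = "lc (Suc c) (H n)"
    have L: "subgroup ?L G" "closedin T ?L" "?L \<lhd> G" using closed_normalD[OF closed_normal_lc[OF Hcn]] by auto
    then have "open_normal ?L"
      using openin_closed_finite_index[OF L(1,2)] fi by (simp add: finite_index_def open_normal_def)
    then have "open_normal N" using open_normal_superset[OF _ N(1) n] by blast
    then show ?thesis
      using finite_rcosets_open open_normalD by (simp add: FactGroup_def)
  qed
  then show "just_infinite G T"
    unfolding just_infinite_def
    using infinite_carrier_strict_chain[of H] dec open_normalD(5)[OF Ho] by blast
qed

end

theorem theorem3p5:
  fixes G :: "('a, 'b) monoid_scheme" and T :: "'a topology" and c :: nat
  assumes "profinite_group G T" and "topologically_fg G T" and "Fitting_free G T"
  shows "(JNNF c G T \<longleftrightarrow> (\<exists>H. JNN_sequence c G T H)) \<and>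
    (\<forall>H. JNN_sequence c G T H \<longrightarrow>
       (just_infinite G T \<longleftrightarrow> (\<forall>n. finite_index G (lower_central G T (c + 1) (H n)))))"
proof -
  interpret profinite_group G T by fact
  show ?thesis
    using JNN_sequence_imp_JNNF[OF assms(3)] JNNF_imp_JNN_sequence[OF assms(2,3)]
      JNN_sequence_just_infinite_iff[OF assms(3)] by auto
qed

end
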